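(* Let $\kappa$ be a regular uncountable cardinal and $\mu$ a cardinal. Suppose that $\vec C$ is a weakly coherent $C$-sequence over $\kappa$ such that $V(\vec C)$ contains a club in $\kappa$, and $\omega\in\Theta_1^\mu(\vec C\restriction A(\vec C),R(\vec C))$. Then $T(\rho_0^{\vec C})\nrightarrow[\kappa]^{n,1}_\mu$ holds for every positive integer $n$.
   Context: A $C$-sequence over $S\subseteq\kappa$ is $\langle C_\delta\mid\delta\in S\rangle$, each $C_\delta$ closed in $\delta$ with $\sup(C_\delta)=\sup(\delta)$. Weakly coherent: for every $\epsilon<\kappa$, $|\{C_\delta\cap\epsilon\mid\delta<\kappa\}|<\kappa$. $\mathrm{acc}(\kappa)$: nonzero limit ordinals below $\kappa$; $\mathrm{acc}(A)=\{\alpha\in A\mid\sup(A\cap\alpha)=\alpha>0\}$, $\mathrm{nacc}(A)=A\setminus\mathrm{acc}(A)$. $V(\vec C)=\{\delta\in\mathrm{acc}(\kappa)\mid\forall\alpha\in(\delta,\kappa)\,\forall\epsilon<\delta\,[C_\delta\cap[\epsilon,\delta)\ne C_\alpha\cap[\epsilon,\delta)]\}$; $A(\vec C)=\{\delta\in\mathrm{acc}(\kappa)\mid\forall\alpha\in(\delta,\kappa)\,[\delta\notin\mathrm{acc}(C_\alpha)]\}$; $R(\vec C)=\{\delta\in\mathrm{acc}(\kappa)\mid\forall\alpha\in(\delta,\kappa)\,[\mathrm{otp}(C_\alpha\cap\delta)<\delta]\}$. For $S,T\subseteq\kappa$, a $C$-sequence $\langle C_\delta\mid\delta\in S\rangle$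 and a cardinal $\mu$, $\Theta_1^\mu(\vec C,T)$ is the set of nonzero cardinals $\theta$ for which there are $g:\kappa\to\mu$, $h:\kappa\to\theta$ such that for every club $D\subseteq\kappa$ and every $\nu<\mu$ there is $\delta\in S$ with, for every $\tau<\theta$, $\sup\{\gamma\in\mathrm{nacc}(C_\delta)\cap D\cap T\mid g(\mathrm{otp}(C_\delta\cap\gamma))=\nu,\ h(\mathrm{otp}(C_\delta\cap\gamma))=\tau\}=\delta$. Here $\vec C\restriction A(\vec C)=\langle C_\delta\mid\delta\in A(\vec C)\rangle$. Walks along $\vec C=\langle C_\delta\mid\delta<\kappa\rangle$: for $\beta<\gamma$, $\mathrm{Tr}(\beta,\gamma)(0)=\gamma$, $\mathrm{Tr}(\beta,\gamma)(n)=\min(C_{\mathrm{Tr}(\beta,\gamma)(n-1)}\setminus\beta)$ if $\mathrm{Tr}(\beta,\gamma)(n-1)>\beta$, else $\beta$; $\rho_2(\beta,\gamma)$ = least $l$ with $\mathrm{Tr}(\beta,\gamma)(l)=\beta$; $\rho_0(\beta,\gamma)=\langle\mathrm{otp}(C_{\mathrm{Tr}(\beta,\gamma)(n)}\cap\beta)\mid n<\rho_2(\beta,\gamma)\rangle$. $T(\rho_0^{\vec C})=\{\rho_{0\delta}\restriction\gamma\mid\gamma\le\delta<\kappa\}$ where $\rho_{0\delta}(\xi)=\rho_0(\xi,\delta)$ for $\xi<\delta$; it is ordered by $\subseteq$ and the height of $t$ is $\mathrm{dom}(t)$. Lexicographic order: for sequences $f,g$, if comparable then $f<_{\mathrm{lex}}g$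 iff $f\supsetneq g$; otherwise at the least $i$ with $f(i)\ne g(i)$, $f<_{\mathrm{lex}}g$ iff $f(i)<g(i)$, where on ${}^{<\omega}\kappa$ entries are compared as ordinals and on $T(\rho_0^{\vec C})$ entries (elements of ${}^{<\omega}\kappa$) are compared by $<_{\mathrm{lex}}$. For nodes $x,y$, $\Delta(x,y)$ is the least common-domain point where they differ, or $\min\{\mathrm{dom}(x),\mathrm{dom}(y)\}$ if none; $x\wedge y=x\restriction\Delta(x,y)$. A set $S$ of $n$-sequences of nodes is rapid if for $\sigma\ne\sigma'$ in $S$ all heights of nodes in $\sigma$ are below all heights in $\sigma'$ or vice versa. $T\nrightarrow[\kappa]^{n,m}_\theta$: there is $c:T\to\theta$ with (1) for every rapid $S\subseteq{}^nT$ of size $\kappa$ and $\tau<\theta$ there are $(x_k)_{k<n}\ne(y_k)_{k<n}$ in $S$ with $c(x_k\wedge y_k)=\tau$ for all $k$, for all $k$ ($x_k<_{\mathrm{lex}}y_k\Rightarrow\mathrm{dom}(x_k)<\mathrm{dom}(y_k)$), and $|\{\mathrm{dom}(x_k\wedge y_k)\mid k<n\}|\le m$; (2) for every $T'\subseteq T$ of size $\kappa$ there is a rapid $S'\subseteq{}^nT'$ of size $\kappa$ such that for every $S\subseteq S'$ of size $\kappa$ and every $\tau\in{}^n\theta$ there are $(x_k)\ne(y_k)$ in $S$ with $c(x_k\wedge y_k)=\tau(k)$ for all $k$ and the last two conditions of (1). *)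

theory Defs
  imports "HOL-Library.Equipollence" "HOL-Library.Countable_Set"
begin

(* Ordinals below kappa are the elements of a well-ordered type 'a whose
   order type is kappa (see the assumptions of theorem9p2). *)

definition lim_ord :: "'a::wellorder \<Rightarrow> bool" where
  "lim_ord \<delta> \<longleftrightarrow> (\<exists>x. x < \<delta>) \<and> (\<forall>\<beta><\<delta>. \<exists>\<gamma>. \<beta> < \<gamma> \<and> \<gamma> < \<delta>)"

definition acc_set :: "'a::wellorder set \<Rightarrow> 'a set" where
  "acc_set X = {\<alpha>\<in>X. (\<exists>x. x < \<alpha>) \<and> (\<forall>\<beta><\<alpha>. \<exists>\<gamma>\<in>X. \<beta> < \<gamma> \<and> \<gamma> < \<alpha>)}"

definition nacc_set :: "'a::wellorder set \<Rightarrow> 'a set" where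
  "nacc_set X = X - acc_set X"

definition sup_is :: "'a::wellorder set \<Rightarrow> 'a \<Rightarrow> bool" where
  "sup_is X \<delta> \<longleftrightarrow> (\<forall>\<gamma>\<in>X. \<gamma> \<le> \<delta>) \<and> (\<forall>\<beta><\<delta>. \<exists>\<gamma>\<in>X. \<beta> < \<gamma>)"

definition otp :: "'a::wellorder set \<Rightarrow> 'a" where
  "otp X = (THE a. \<exists>f. bij_betw f {x. x < a} X \<and> strict_mono_on {x. x < a} f)"

definition club :: "'a::wellorder set \<Rightarrow> bool" where
  "club D \<longleftrightarrow> (\<forall>\<beta>. \<exists>\<gamma>\<in>D. \<beta> \<le> \<gamma>) \<and>
     (\<forall>\<alpha>. (\<exists>x. x < \<alpha>) \<and> (\<forall>\<beta><\<alpha>. \<exists>\<gamma>\<in>D. \<beta> < \<gamma> \<and> \<gamma> < \<alpha>) \<longrightarrow> \<alpha> \<in> D)"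

definition C_sequence :: "('a::wellorder \<Rightarrow> 'a set) \<Rightarrow> bool" where
  "C_sequence C \<longleftrightarrow> (\<forall>\<delta>. C \<delta> \<subseteq> {x. x < \<delta>}
      \<and> (\<forall>\<alpha><\<delta>. (\<exists>x. x < \<alpha>) \<and> (\<forall>\<beta><\<alpha>. \<exists>\<gamma>\<in>C \<delta>. \<beta> < \<gamma> \<and> \<gamma> < \<alpha>) \<longrightarrow> \<alpha> \<in> C \<delta>)
      \<and> (\<forall>\<beta><\<delta>. \<exists>\<gamma>\<in>C \<delta>. \<beta> \<le> \<gamma>))"

definition weakly_coherent :: "('a::wellorder \<Rightarrow> 'a set) \<Rightarrow> bool" where
  "weakly_coherent C \<longleftrightarrow> (\<forall>\<epsilon>. {C \<delta> \<inter> {x. x < \<epsilon>} | \<delta>. True} \<prec> (UNIV :: 'a set))"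

definition V_set :: "('a::wellorder \<Rightarrow> 'a set) \<Rightarrow> 'a set" where
  "V_set C = {\<delta>. lim_ord \<delta> \<and> (\<forall>\<alpha>. \<delta> < \<alpha> \<longrightarrow> (\<forall>\<epsilon><\<delta>.
       C \<delta> \<inter> {\<epsilon>..<\<delta>} \<noteq> C \<alpha> \<inter> {\<epsilon>..<\<delta>}))}"

definition A_set :: "('a::wellorder \<Rightarrow> 'a set) \<Rightarrow> 'a set" where
  "A_set C = {\<delta>. lim_ord \<delta> \<and> (\<forall>\<alpha>. \<delta> < \<alpha> \<longrightarrow> \<delta> \<notin> acc_set (C \<alpha>))}"

definition R_set :: "('a::wellorder \<Rightarrow> 'a set) \<Rightarrow> 'a set" where
  "R_set C = {\<delta>. lim_ord \<delta> \<and> (\<forall>\<alpha>. \<delta> < \<alpha> \<longrightarrow> otp (C \<alpha> \<inter> {x. x < \<delta>}) < \<delta>)}"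

text \<open>theta in Theta_1^mu(C restricted to S, T): mu is represented by a colour set G
  (of cardinality mu) and theta by a colour set H (of cardinality theta).\<close>
definition Theta1 :: "'a::wellorder set \<Rightarrow> ('a \<Rightarrow> 'a set) \<Rightarrow> 'a set \<Rightarrow> 'm set \<Rightarrow> 't set \<Rightarrow> bool" where
  "Theta1 S C T G H \<longleftrightarrow> (\<exists>(g::'a \<Rightarrow> 'm) (h::'a \<Rightarrow> 't). (\<forall>x. g x \<in> G) \<and> (\<forall>x. h x \<in> H) \<and>
     (\<forall>D. club D \<longrightarrow> (\<forall>\<nu>\<in>G. \<exists>\<delta>\<in>S. \<forall>\<tau>\<in>H.
        sup_is {\<gamma> \<in> nacc_set (C \<delta>) \<inter> D \<inter> T.
                  g (otp (C \<delta> \<inter> {x. x < \<gamma>})) = \<nu> \<and> h (otp (C \<delta> \<inter> {x. x < \<gamma>})) = \<tau>} \<delta>)))"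

definition tr_step :: "('a::wellorder \<Rightarrow> 'a set) \<Rightarrow> 'a \<Rightarrow> 'a \<Rightarrow> 'a" where
  "tr_step C \<beta> x = (if \<beta> < x then (LEAST y. y \<in> C x \<and> \<beta> \<le> y) else \<beta>)"

definition Tr :: "('a::wellorder \<Rightarrow> 'a set) \<Rightarrow> 'a \<Rightarrow> 'a \<Rightarrow> nat \<Rightarrow> 'a" where
  "Tr C \<beta> \<gamma> n = (tr_step C \<beta> ^^ n) \<gamma>"

definition rho2 :: "('a::wellorder \<Rightarrow> 'a set) \<Rightarrow> 'a \<Rightarrow> 'a \<Rightarrow> nat" where
  "rho2 C \<beta> \<gamma> = (LEAST l. Tr C \<beta> \<gamma> l = \<beta>)"

definition rho0 :: "('a::wellorder \<Rightarrow> 'a set) \<Rightarrow> 'a \<Rightarrow> 'a \<Rightarrow> 'a list" where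
  "rho0 C \<beta> \<gamma> = map (\<lambda>n. otp (C (Tr C \<beta> \<gamma> n) \<inter> {x. x < \<beta>})) [0..<rho2 C \<beta> \<gamma>]"

text \<open>A node of height gamma is represented as (gamma, f) with f xi = [] for xi >= gamma.\<close>
type_synonym 'a node = "'a \<times> ('a \<Rightarrow> 'a list)"

definition restr :: "('a::wellorder \<Rightarrow> 'a list) \<Rightarrow> 'a \<Rightarrow> 'a node" where
  "restr f \<gamma> = (\<gamma>, \<lambda>\<xi>. if \<xi> < \<gamma> then f \<xi> else [])"

definition rho0_tree :: "('a::wellorder \<Rightarrow> 'a set) \<Rightarrow> 'a node set" where
  "rho0_tree C = {restr (\<lambda>\<xi>. rho0 C \<xi> \<delta>) \<gamma> | \<gamma> \<delta>. \<gamma> \<le> \<delta>}"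

definition lex_lt :: "'a::wellorder list \<Rightarrow> 'a list \<Rightarrow> bool" where
  "lex_lt xs ys \<longleftrightarrow> (length ys < length xs \<and> take (length ys) xs = ys) \<or>
     (\<exists>i. i < length xs \<and> i < length ys \<and> take i xs = take i ys \<and> xs ! i < ys ! i)"

definition node_lex :: "'a::wellorder node \<Rightarrow> 'a node \<Rightarrow> bool" where
  "node_lex x y \<longleftrightarrow> (fst y < fst x \<and> (\<forall>\<xi><fst y. snd x \<xi> = snd y \<xi>)) \<or>
     (\<exists>i. i < fst x \<and> i < fst y \<and> (\<forall>\<xi><i. snd x \<xi> = snd y \<xi>) \<and> lex_lt (snd x i) (snd y i))"

definition Delta :: "'a::wellorder node \<Rightarrow> 'a node \<Rightarrow> 'a" where
  "Delta x y = (if \<exists>\<xi>. \<xi> < fst x \<and> \<xi> < fst y \<and> snd x \<xi> \<noteq> snd y \<xi>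
                then (LEAST \<xi>. \<xi> < fst x \<and> \<xi> < fst y \<and> snd x \<xi> \<noteq> snd y \<xi>)
                else min (fst x) (fst y))"

definition meet :: "'a::wellorder node \<Rightarrow> 'a node \<Rightarrow> 'a node" where
  "meet x y = restr (snd x) (Delta x y)"

definition ntuples :: "'a node set \<Rightarrow> nat \<Rightarrow> 'a node list set" where
  "ntuples T n = {xs. length xs = n \<and> set xs \<subseteq> T}"

definition rapid :: "'a::wellorder node list set \<Rightarrow> bool" where
  "rapid S \<longleftrightarrow> (\<forall>\<sigma>\<in>S. \<forall>\<sigma>'\<in>S. \<sigma> \<noteq> \<sigma>' \<longrightarrow>
      (\<forall>x\<in>set \<sigma>. \<forall>y\<in>set \<sigma>'. fst x < fst y) \<or> (\<forall>x\<in>set \<sigma>. \<forall>y\<in>set \<sigma>'. fst y < fst x))"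

definition good_pair :: "('a::wellorder node \<Rightarrow> 'm) \<Rightarrow> nat \<Rightarrow> nat \<Rightarrow> (nat \<Rightarrow> 'm)
     \<Rightarrow> 'a node list \<Rightarrow> 'a node list \<Rightarrow> bool" where
  "good_pair c n m \<tau> xs ys \<longleftrightarrow> xs \<noteq> ys
     \<and> (\<forall>k<n. c (meet (xs ! k) (ys ! k)) = \<tau> k)
     \<and> (\<forall>k<n. node_lex (xs ! k) (ys ! k) \<longrightarrow> fst (xs ! k) < fst (ys ! k))
     \<and> card ((\<lambda>k. fst (meet (xs ! k) (ys ! k))) ` {..<n}) \<le> m"

text \<open>T -/-> [kappa]^{n,m}_theta, with theta represented by the colour set Col;
  "size kappa" means equipollent with the type 'a.\<close>
definition tree_negpart :: "'a::wellorder node set \<Rightarrow> nat \<Rightarrow> nat \<Rightarrow> 'm set \<Rightarrow> bool" where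
  "tree_negpart T n m Col \<longleftrightarrow> (\<exists>c::'a node \<Rightarrow> 'm. (\<forall>t\<in>T. c t \<in> Col) \<and>
     (\<forall>S. S \<subseteq> ntuples T n \<and> rapid S \<and> S \<approx> (UNIV::'a set) \<longrightarrow>
        (\<forall>\<tau>\<in>Col. \<exists>xs\<in>S. \<exists>ys\<in>S. good_pair c n m (\<lambda>_. \<tau>) xs ys)) \<and>
     (\<forall>T'. T' \<subseteq> T \<and> T' \<approx> (UNIV::'a set) \<longrightarrow>
        (\<exists>S'. S' \<subseteq> ntuples T' n \<and> rapid S' \<and> S' \<approx> (UNIV::'a set) \<and>
           (\<forall>S. S \<subseteq> S' \<and> S \<approx> (UNIV::'a set) \<longrightarrow>
              (\<forall>\<tau>. (\<forall>k<n. \<tau> k \<in> Col) \<longrightarrow> (\<exists>xs\<in>S. \<exists>ys\<in>S. good_pair c n m \<tau> xs ys))))))"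

end

theory Submission
  imports Defs "HOL-Library.Nat_Bijection" "HOL-Library.Countable"
begin

text \<open>
  A node of the tree is read at the last point e of a club \<open>E \<subseteq> V(C)\<close> below its height: the walk to e
  becomes a finite word of letters in \<open>\<omega>\<close> (the values of h), decorated with colours (the values of g).
  Suppose \<open>\<delta> \<in> A(C)\<close>, \<open>\<gamma> \<in> nacc(C\<^bsub>\<delta>\<^esub>) \<inter> R(C)\<close> is guessed and tuples of S lie above \<open>\<delta>\<close>. Just
  below \<open>\<gamma>\<close> the walks of all these tuples go through \<open>\<delta>\<close> and then \<open>\<gamma>\<close>, hence consist of an individual word
  followed by the letter of \<open>\<gamma>\<close> and a common rest. Since \<open>\<gamma> \<in> R(C)\<close>, the data describing the tuples at
  \<open>\<gamma>\<close> lie below \<open>\<gamma>\<close>, so they recur at some \<open>\<gamma>' > \<gamma>\<close>; because \<open>\<gamma> \<in> V(C)\<close> the walks from \<open>\<gamma>\<close> and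
  \<open>\<gamma>'\<close> split below \<open>\<gamma>\<close>, at the same point for all tuples and coordinates.

  The rest of the walk below \<open>\<gamma>\<close> is out of control, so the colouring has to recognise the letter of
  \<open>\<gamma>\<close> in the word whatever follows it. This is achieved by letting the letter code n+1 tuples of words
  and by choosing, depending on the rest u, one of the tuples that is entitled to be read at this
  letter. The choices can be made without conflicts as long as the coded tuples lie in different
  components of the graph that links words competing for readings; these components are
  finite, and walks from S to \<open>\<delta>\<close> are arbitrarily long, so suitable tuples are available.
\<close>

subsection \<open>Reading finite words\<close>

text \<open>The second component of the decoded pair carries the tuples; the first is padding that
  makes the code N as large as desired. The guard forces every letter of a coded word below its
  code, and the finiteness of components rests on this.\<close>

definition coded_tuples :: "nat \<Rightarrow> nat list list list" where
  "coded_tuples N = (let Q = from_nat (snd (prod_decode N)) in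
     if \<forall>\<tau>\<in>set Q. \<forall>\<rho>\<in>set \<tau>. \<forall>a\<in>set \<rho>. a < N then Q else [])"

definition coded_words :: "nat \<Rightarrow> nat list set" where
  "coded_words N = (\<Union>\<tau>\<in>set (coded_tuples N). set \<tau>)"

lemma finite_coded_words: "finite (coded_words N)"
  by (simp add: coded_words_def)

lemma coded_words_less: "\<rho> \<in> coded_words N \<Longrightarrow> a \<in> set \<rho> \<Longrightarrow> a < N"
  by (auto simp: coded_words_def coded_tuples_def Let_def split: if_splits)

lemma coded_tuples_surj: "\<exists>N. coded_tuples N = Q"
proof -
  \<comment> \<open>A nested sum in place of a maximum bounds all letters without a case for empty
    lists.\<close>
  define b where "b = Suc (\<Sum>\<tau>\<leftarrow>Q. \<Sum>\<rho>\<leftarrow>\<tau>. sum_list \<rho>)"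
  have "a < b" if "\<tau> \<in> set Q" "\<rho> \<in> set \<tau>" "a \<in> set \<rho>" for \<tau> \<rho> a
  proof -
    have "a \<le> sum_list \<rho>" using that by (simp add: member_le_sum_list)
    also have "\<dots> \<le> (\<Sum>\<rho>\<leftarrow>\<tau>. sum_list \<rho>)"
      using that by (intro member_le_sum_list) auto
    also have "\<dots> \<le> (\<Sum>\<tau>\<leftarrow>Q. \<Sum>\<rho>\<leftarrow>\<tau>. sum_list \<rho>)"
      using that by (intro member_le_sum_list) auto
    finally show ?thesis by (simp add: b_def)
  qed
  moreover have "b \<le> prod_encode (b, to_nat Q)" by (rule le_prod_encode_1)
  ultimately have "coded_tuples (prod_encode (b, to_nat Q)) = Q"
    by (auto simp: coded_tuples_def Let_def) (meson order_less_le_trans)+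
  then show ?thesis by blast
qed

text \<open>The edges of the graph of competing words: both words meet the letter N with the same
  rest u, and N codes both prefixes. The relation is symmetric, so its reflexive transitive closure
  is connectedness in this graph.\<close>

inductive swap_prefix :: "nat list \<Rightarrow> nat list \<Rightarrow> bool" where
  "\<rho> \<in> coded_words N \<Longrightarrow> \<rho>' \<in> coded_words N \<Longrightarrow> swap_prefix (\<rho> @ N # u) (\<rho>' @ N # u)"

definition component :: "nat list \<Rightarrow> nat list set" where
  "component w = {w'. swap_prefix\<^sup>*\<^sup>* w w'}"

lemma component_refl: "w \<in> component w"
  by (simp add: component_def)

lemma component_sym: "w' \<in> component w \<Longrightarrow> w \<in> component w'"
proof -
  have "symp swap_prefix" by (auto intro!: sympI elim!: swap_prefix.cases intro: swap_prefix.intros)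
  then show "w' \<in> component w \<Longrightarrow> w \<in> component w'"
    by (auto simp: component_def dest: sympD[OF symp_rtranclp])
qed

lemma component_eq: "w' \<in> component w \<Longrightarrow> component w' = component w"
  using component_sym by (fastforce simp: component_def)

lemma component_step: "w' \<in> component w \<Longrightarrow> swap_prefix w' w'' \<Longrightarrow> w'' \<in> component w"
  by (auto simp: component_def)

lemma component_append: "w' \<in> component w \<Longrightarrow> w' @ v \<in> component (w @ v)"
proof -
  have st: "swap_prefix (x @ v) (y @ v)" if "swap_prefix x y" for x y
    using that by cases (auto intro: swap_prefix.intros)
  assume "w' \<in> component w"
  then have "swap_prefix\<^sup>*\<^sup>* w w'" by (simp add: component_def)
  then have "swap_prefix\<^sup>*\<^sup>* (w @ v) (w' @ v)"
    by induction (auto intro: st rtranclp.rtrancl_into_rtrancl)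
  then show ?thesis by (simp add: component_def)
qed

text \<open>A single swap with empty rest. Words from different components thus fall into one
  component once their common code N is appended, which drives the pigeonhole argument for choosing
  tuples.\<close>

lemma component_coded: "\<rho> \<in> coded_words N \<Longrightarrow> \<rho>' \<in> coded_words N \<Longrightarrow> \<rho>' @ [N] \<in> component (\<rho> @ [N])"
  using swap_prefix.intros[of \<rho> N \<rho>' "[]"] by (auto simp: component_def)

lemma component_subset_closed:
  assumes "w \<in> Z" "\<And>x y. x \<in> Z \<Longrightarrow> swap_prefix x y \<Longrightarrow> y \<in> Z"
  shows "component w \<subseteq> Z"
proof
  fix w' assume "w' \<in> component w"
  then have "swap_prefix\<^sup>*\<^sup>* w w'" by (simp add: component_def)
  then show "w' \<in> Z" by induction (use assms in auto)
qed

text \<open>A swap at a letter N needs all letters before it to be smaller than N, so no swap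
  happens to the right of the last occurrence of the largest letter, and a swap at that
  occurrence leads to one of finitely many prefixes with smaller letters.\<close>
lemma finite_component: "finite (component w)"
proof -
  \<comment> \<open>The outer induction is on a strict bound m for the letters, the inner one on the
    length of the word.\<close>
  have "\<forall>a\<in>set w. a < m \<Longrightarrow> finite (component w)" for m
  proof (induction m arbitrary: w)
    case 0
    then have "w = []" by (cases w) auto
    then have "component w \<subseteq> {[]}" by (intro component_subset_closed) (auto elim: swap_prefix.cases)
    then show ?case by (rule finite_subset) simp
  next
    case (Suc m)
    from Suc.prems show ?case
    proof (induction "length w" arbitrary: w rule: less_induct)
      case less
      show ?case
      proof (cases "m \<in> set w")
        case False
        then have "\<forall>a\<in>set w. a < m" using less.prems less_Suc_eq by metis
        then show ?thesis by (rule Suc.IH)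
      next
        case True
        then obtain x s where w: "w = x @ m # s" and s: "m \<notin> set s"
          by (meson split_list_last)
        have s_less: "a < m" if "a \<in> set s" for a
          using less.prems that s w less_Suc_eq by auto
        \<comment> \<open>Prefixes that can occur before the last m: those reached from x, which is
          shorter than w, by swaps to the left of it, and those started by a swap at it, whose
          letters lie below m.\<close>
        define Z where "Z = component x \<union> (\<Union>q\<in>coded_words m. component q)"
        have "finite (component x)" using less w by auto
        moreover have "finite (component q)" if "q \<in> coded_words m" for q
          using Suc.IH coded_words_less[OF that] by blast
        ultimately have "finite Z" by (simp add: Z_def finite_coded_words)
        moreover have "component w \<subseteq> (\<lambda>x'. x' @ m # s) ` Z"
        proof (rule component_subset_closed)
          show "w \<in> (\<lambda>x'. x' @ m # s) ` Z" by (simp add: w Z_def component_refl)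
          fix y y' assume "y \<in> (\<lambda>x'. x' @ m # s) ` Z" and st: "swap_prefix y y'"
          then obtain x' where x': "x' \<in> Z" "y = x' @ m # s" by auto
          from st obtain \<rho> N \<rho>' u where
            y: "y = \<rho> @ N # u" "y' = \<rho>' @ N # u" and \<rho>: "\<rho> \<in> coded_words N" "\<rho>' \<in> coded_words N"
            by cases
          from x'(2) y(1) have "\<rho> @ N # u = x' @ m # s" by simp
          then consider (less) v where "x' = \<rho> @ N # v" "u = v @ m # s"
            | (eq) "x' = \<rho>" "N = m" "u = s"
            | (gr) v where "\<rho> = x' @ m # v" "s = v @ N # u"
            by (auto simp: append_eq_append_conv2 Cons_eq_append_conv append_eq_Cons_conv)
          then show "y' \<in> (\<lambda>x'. x' @ m # s) ` Z"
          proof cases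
            case less
            then have "swap_prefix x' (\<rho>' @ N # v)" using \<rho> by (simp add: swap_prefix.intros)
            then have "\<rho>' @ N # v \<in> Z" using x'(1) component_step by (auto simp: Z_def)
            then show ?thesis using y less by auto
          next
            case eq
            then have "\<rho>' \<in> Z" using \<rho> component_refl by (auto simp: Z_def)
            then show ?thesis using y eq by auto
          next
            case gr
            \<comment> \<open>A swap to the right of the last m has m in its prefix, so its letter N
              exceeds m; but N occurs in s and is therefore below m.\<close>
            then have "m < N" using coded_words_less[OF \<rho>(1), of m] by simp
            moreover have "N < m" using gr s_less by simp
            ultimately show ?thesis by simp
          qed
        qed
        ultimately show ?thesis by (rule finite_surj)
      qed
    qed
  qed
  from this[of "Suc (sum_list w)"] show ?thesis
    by (auto simp: le_imp_less_Suc member_le_sum_list)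
qed

section \<open>Choosing the tuple that is read at a letter\<close>

definition legit :: "nat \<Rightarrow> nat \<Rightarrow> bool" where
  "legit n N \<longleftrightarrow> length (coded_tuples N) = Suc n \<and> (\<forall>\<tau>\<in>set (coded_tuples N). length \<tau> = n) \<and>
     (\<forall>i j. i < j \<longrightarrow> j < Suc n \<longrightarrow> (\<forall>\<rho>\<in>set (coded_tuples N ! i). \<forall>\<rho>'\<in>set (coded_tuples N ! j).
        component \<rho> \<noteq> component \<rho>'))"

definition choose_tuple :: "nat \<Rightarrow> nat list set \<Rightarrow> nat list list" where
  "choose_tuple N Z = (SOME \<tau>. \<tau> \<in> set (coded_tuples N) \<and> (\<forall>\<rho>\<in>set \<tau>. component \<rho> \<inter> {x. x @ [N] \<in> Z} = {}))"

text \<open>The recursion starts at the end of the word: \<open>claimed n u\<close> collects the x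
  for which \<open>x @ u\<close> is read at some letter of u. A letter further left chooses its
  tuple in view of all choices to its right.\<close>

primrec claimed :: "nat \<Rightarrow> nat list \<Rightarrow> nat list set" where
  "claimed n [] = {}"
| "claimed n (N # u) = {x. x @ [N] \<in> claimed n u} \<union>
     (if legit n N then set (choose_tuple N (claimed n u)) else {})"

lemma finite_claimed_component: "finite (claimed n u \<inter> component w)"
  by (simp add: finite_component)

text \<open>Pigeonhole. If each of the n+1 tuples were blocked, each would yield a word of Z ending
  in N. These words are distinct because the tuples lie in different components, yet
  \<open>component_coded\<close> puts them all into one component, where Z has at most n
  elements.\<close>

lemma choose_tuple_props:
  assumes "legit n N" and inv: "\<And>w. card (Z \<inter> component w) \<le> n"
  shows "choose_tuple N Z \<in> set (coded_tuples N)"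
    and "\<rho> \<in> set (choose_tuple N Z) \<Longrightarrow> component \<rho> \<inter> {x. x @ [N] \<in> Z} = {}"
proof -
  define Q where "Q = coded_tuples N"
  have len: "length Q = Suc n" and
    disj: "\<And>i j \<rho> \<rho>'. i < j \<Longrightarrow> j < Suc n \<Longrightarrow> \<rho> \<in> set (Q ! i) \<Longrightarrow> \<rho>' \<in> set (Q ! j) \<Longrightarrow> component \<rho> \<noteq> component \<rho>'"
    using assms(1) by (auto simp: legit_def Q_def)
  have "\<exists>i<Suc n. \<forall>\<rho>\<in>set (Q ! i). component \<rho> \<inter> {x. x @ [N] \<in> Z} = {}"
  proof (rule ccontr)
    assume "\<not> ?thesis"
    then have "\<forall>i<Suc n. \<exists>\<rho> x. \<rho> \<in> set (Q ! i) \<and> x \<in> component \<rho> \<and> x @ [N] \<in> Z" by fast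
    then obtain \<rho> x where \<rho>: "\<And>i. i < Suc n \<Longrightarrow> \<rho> i \<in> set (Q ! i)"
      and x: "\<And>i. i < Suc n \<Longrightarrow> x i \<in> component (\<rho> i)" "\<And>i. i < Suc n \<Longrightarrow> x i @ [N] \<in> Z" by metis
    have cw: "\<rho> i \<in> coded_words N" if "i < Suc n" for i
      using \<rho>[OF that] that len by (auto simp: coded_words_def Q_def[symmetric] intro!: bexI[of _ "Q ! i"])
    have inj: "inj_on (\<lambda>i. x i @ [N]) {..<Suc n}"
    proof (rule linorder_inj_onI)
      fix i j assume "i < j" "i \<in> {..<Suc n}" "j \<in> {..<Suc n}"
      then have "component (\<rho> i) \<noteq> component (\<rho> j)" using disj \<rho> by simp
      then show "x i @ [N] \<noteq> x j @ [N]"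
        using component_eq[OF x(1)[of i]] component_eq[OF x(1)[of j]] \<open>i \<in> _\<close> \<open>j \<in> _\<close> by auto
    qed auto
    have "(\<lambda>i. x i @ [N]) ` {..<Suc n} \<subseteq> Z \<inter> component (\<rho> 0 @ [N])"
    proof (intro subsetI IntI; elim imageE)
      fix y i assume y: "y = x i @ [N]" "i \<in> {..<Suc n}"
      then show "y \<in> Z" using x(2) by simp
      have "component (\<rho> i @ [N]) = component (\<rho> 0 @ [N])"
        using y by (intro component_eq component_coded cw) auto
      then show "y \<in> component (\<rho> 0 @ [N])"
        using y component_append[OF x(1), of i "[N]"] by simp
    qed
    then have "card ((\<lambda>i. x i @ [N]) ` {..<Suc n}) \<le> n"
      using inv card_mono[of "Z \<inter> component (\<rho> 0 @ [N])"] finite_component by (meson finite_Int le_trans)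
    then show False using card_image[OF inj] by simp
  qed
  then have "\<exists>\<tau>. \<tau> \<in> set (coded_tuples N) \<and> (\<forall>\<rho>\<in>set \<tau>. component \<rho> \<inter> {x. x @ [N] \<in> Z} = {})"
    using len by (metis Q_def nth_mem)
  from someI_ex[OF this]
  show "choose_tuple N Z \<in> set (coded_tuples N)"
    and "\<rho> \<in> set (choose_tuple N Z) \<Longrightarrow> component \<rho> \<inter> {x. x @ [N] \<in> Z} = {}"
    by (auto simp: choose_tuple_def)
qed

text \<open>The bound survives a letter N. Words inherited from u are counted after appending N,
  inside a single component. If the chosen tuple meets a component, its choice ensures that no
  inherited word lies there, so at most its n entries remain.\<close>

lemma card_claimed_component: "card (claimed n u \<inter> component w) \<le> n"
proof (induction u arbitrary: w)
  case (Cons N u)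
  let ?Y' = "{x. x @ [N] \<in> claimed n u}"
  have Y': "card (?Y' \<inter> component w) \<le> n" for w
  proof -
    have "card (?Y' \<inter> component w) = card ((\<lambda>x. x @ [N]) ` (?Y' \<inter> component w))"
      by (simp add: card_image inj_on_def)
    also have "\<dots> \<le> card (claimed n u \<inter> component (w @ [N]))"
      using component_append by (intro card_mono finite_claimed_component) auto
    also have "\<dots> \<le> n" by (rule Cons.IH)
    finally show ?thesis .
  qed
  show ?case
  proof (cases "legit n N \<and> set (choose_tuple N (claimed n u)) \<inter> component w \<noteq> {}")
    case True
    let ?\<tau> = "choose_tuple N (claimed n u)"
    from True obtain \<rho> where \<rho>: "\<rho> \<in> set ?\<tau>" "\<rho> \<in> component w" by auto
    note props = choose_tuple_props[OF conjunct1[OF True] Cons.IH]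
    have "component w \<inter> ?Y' = {}" using props(2)[OF \<rho>(1)] component_eq[OF \<rho>(2)] by simp
    then have "claimed n (N # u) \<inter> component w \<subseteq> set ?\<tau>" using True by auto
    then have "card (claimed n (N # u) \<inter> component w) \<le> length ?\<tau>"
      by (meson List.finite_set card_length card_mono order_trans)
    also have "length ?\<tau> = n" using props(1) True by (auto simp: legit_def)
    finally show ?thesis .
  next
    case False
    then have "claimed n (N # u) \<inter> component w = ?Y' \<inter> component w" by auto
    then show ?thesis using Y' by simp
  qed
qed simp

definition sel :: "nat \<Rightarrow> nat \<Rightarrow> nat list \<Rightarrow> nat list list" where
  "sel n N u = (if legit n N then choose_tuple N (claimed n u) else [])"

lemma claimed_append: "x @ v \<in> claimed n u \<Longrightarrow> x \<in> claimed n (v @ u)"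
proof (induction v arbitrary: x)
  case (Cons a v)
  then show ?case using Cons.IH[of "x @ [a]"] by simp
qed simp

text \<open>If the second reading takes place further right, its word is
  \<open>\<rho> @ N # v\<close>, so \<open>\<rho> @ [N]\<close> is claimed by u; but the choice at N
  avoids claims in the whole component of \<rho>.\<close>

lemma sel_unique:
  assumes "\<rho> \<in> set (sel n N u)" "\<rho>' \<in> set (sel n N' u')" "\<rho> @ N # u = \<rho>' @ N' # u'"
  shows "length \<rho> = length \<rho>'"
proof -
  have False if lt: "length \<rho> < length \<rho>'" and 1: "\<rho> \<in> set (sel n N u)" and 2: "\<rho>' \<in> set (sel n N' u')"
    and eq: "\<rho> @ N # u = \<rho>' @ N' # u'" for \<rho> N u \<rho>' N' u'
  proof -
    obtain v where v: "\<rho>' = \<rho> @ N # v" "u = v @ N' # u'"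
      using eq lt by (fastforce simp: append_eq_append_conv2 Cons_eq_append_conv append_eq_Cons_conv)
    have "\<rho>' \<in> claimed n (N' # u')" using 2 by (auto simp: sel_def split: if_splits)
    then have "\<rho> @ [N] \<in> claimed n u" using claimed_append[of "\<rho> @ [N]" v n "N' # u'"] v by simp
    moreover have "component \<rho> \<inter> {x. x @ [N] \<in> claimed n u} = {}"
      using 1 choose_tuple_props(2)[OF _ card_claimed_component] by (auto simp: sel_def split: if_splits)
    ultimately show False using component_refl[of \<rho>] by blast
  qed
  then show ?thesis using assms by (metis linorder_neqE_nat)
qed

text \<open>Components are finite, so tuples avoiding the components of all earlier ones can be
  picked one by one. A code of n+1 such tuples is a letter that, whatever follows it, selects from a
  fixed finite part of F.\<close>

lemma sel_among:
  assumes len: "\<And>\<tau>. \<tau> \<in> F \<Longrightarrow> length \<tau> = n"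
    and esc: "\<And>B. finite B \<Longrightarrow> \<exists>\<tau>\<in>F. set \<tau> \<inter> B = {}"
  shows "\<exists>N Q. finite Q \<and> Q \<subseteq> F \<and> (\<forall>u. sel n N u \<in> Q)"
proof -
  have "\<exists>Q. length Q = m \<and> set Q \<subseteq> F \<and>
     (\<forall>i j. i < j \<longrightarrow> j < m \<longrightarrow> (\<forall>\<rho>\<in>set (Q ! i). \<forall>\<rho>'\<in>set (Q ! j). component \<rho> \<noteq> component \<rho>'))" for m
  proof (induction m)
    case (Suc m)
    then obtain Q where Q: "length Q = m" "set Q \<subseteq> F"
      "\<forall>i j. i < j \<longrightarrow> j < m \<longrightarrow> (\<forall>\<rho>\<in>set (Q ! i). \<forall>\<rho>'\<in>set (Q ! j). component \<rho> \<noteq> component \<rho>')"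
      by blast
    obtain \<tau> where \<tau>: "\<tau> \<in> F" "set \<tau> \<inter> (\<Union>\<sigma>\<in>set Q. \<Union>\<rho>\<in>set \<sigma>. component \<rho>) = {}"
      using esc[of "\<Union>\<sigma>\<in>set Q. \<Union>\<rho>\<in>set \<sigma>. component \<rho>"] finite_component by auto
    have new: "component \<rho> \<noteq> component \<rho>'" if "i < m" "\<rho> \<in> set (Q ! i)" "\<rho>' \<in> set \<tau>" for i \<rho> \<rho>'
      using \<tau>(2) that Q(1) component_refl[of \<rho>'] nth_mem[of i Q] by blast
    show ?case
      using Q \<tau>(1) new by (intro exI[of _ "Q @ [\<tau>]"]) (auto simp: nth_append less_Suc_eq)
  qed simp
  from this[of "Suc n"] obtain Q where Q: "length Q = Suc n" "set Q \<subseteq> F"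
    "\<forall>i j. i < j \<longrightarrow> j < Suc n \<longrightarrow> (\<forall>\<rho>\<in>set (Q ! i). \<forall>\<rho>'\<in>set (Q ! j). component \<rho> \<noteq> component \<rho>')"
    by blast
  obtain N where N: "coded_tuples N = Q" using coded_tuples_surj by blast
  have leg: "legit n N" unfolding legit_def N using Q len by auto
  have "sel n N u \<in> set Q" for u
    using choose_tuple_props(1)[OF leg card_claimed_component] leg by (simp add: sel_def N)
  then show ?thesis using Q(2) by blast
qed

text \<open>The colours attached to a letter are indexed by the coordinates of the selected tuple. The
  position that is read is unique by \<open>sel_unique\<close>; k need not be.\<close>
definition word_colour :: "nat \<Rightarrow> (nat \<times> 'm list) list \<Rightarrow> 'm" where
  "word_colour n w = (SOME \<nu>. \<exists>w\<^sub>1 N cs w\<^sub>2 k. w = w\<^sub>1 @ (N, cs) # w\<^sub>2 \<and>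
     k < length (sel n N (map fst w\<^sub>2)) \<and> map fst w\<^sub>1 = sel n N (map fst w\<^sub>2) ! k \<and> \<nu> = cs ! k)"

text \<open>By \<open>sel_unique\<close> every witness of the choice has the same position, hence
  the same letter, colour list and rest. Only the coordinate may differ, and cs takes equal values
  at equal entries of the tuple.\<close>

lemma word_colour_eq:
  assumes sel: "sel n N (map fst w\<^sub>2) = \<tau>" and k: "k < length \<tau>" and w\<^sub>1: "map fst w\<^sub>1 = \<tau> ! k"
    and cs: "\<And>k'. k' < length \<tau> \<Longrightarrow> \<tau> ! k' = \<tau> ! k \<Longrightarrow> cs ! k' = cs ! k"
  shows "word_colour n (w\<^sub>1 @ (N, cs) # w\<^sub>2) = cs ! k"
proof -
  let ?P = "\<lambda>\<nu>. \<exists>v\<^sub>1 M m v\<^sub>2 k. w\<^sub>1 @ (N, cs) # w\<^sub>2 = v\<^sub>1 @ (M, m) # v\<^sub>2 \<and>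
     k < length (sel n M (map fst v\<^sub>2)) \<and> map fst v\<^sub>1 = sel n M (map fst v\<^sub>2) ! k \<and> \<nu> = m ! k"
  have "?P (cs ! k)" using sel k w\<^sub>1 by blast
  moreover have "\<nu> = cs ! k" if "?P \<nu>" for \<nu>
  proof -
    from that obtain v\<^sub>1 M m v\<^sub>2 k' where v: "w\<^sub>1 @ (N, cs) # w\<^sub>2 = v\<^sub>1 @ (M, m) # v\<^sub>2"
      "k' < length (sel n M (map fst v\<^sub>2))" "map fst v\<^sub>1 = sel n M (map fst v\<^sub>2) ! k'" "\<nu> = m ! k'"
      by blast
    have "length (map fst w\<^sub>1) = length (map fst v\<^sub>1)"
    proof (rule sel_unique)
      show "map fst w\<^sub>1 \<in> set (sel n N (map fst w\<^sub>2))" using sel k w\<^sub>1 by simp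
      show "map fst v\<^sub>1 \<in> set (sel n M (map fst v\<^sub>2))" using v by simp
      show "map fst w\<^sub>1 @ N # map fst w\<^sub>2 = map fst v\<^sub>1 @ M # map fst v\<^sub>2"
        using arg_cong[OF v(1), of "map fst"] by simp
    qed
    then have "w\<^sub>1 = v\<^sub>1" "N = M" "cs = m" "w\<^sub>2 = v\<^sub>2" using v(1) by auto
    then show ?thesis using v sel w\<^sub>1 cs by auto
  qed
  ultimately show ?thesis unfolding word_colour_def by (rule some_equality)
qed

subsection \<open>Order types\<close>

text \<open>The transitive collapse of X. The recursion gives the order type of X below b in a form
  fit for induction, in contrast to the isomorphisms behind \<open>otp\<close>; the two are
  identified in \<open>otp_eq_rank_below\<close>.\<close>

definition rank_below :: "'a::wellorder set \<Rightarrow> 'a \<Rightarrow> 'a" where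
  "rank_below X = wfrec {(x, y). x < y} (\<lambda>r b. LEAST y. \<forall>z\<in>X. z < b \<longrightarrow> r z < y)"

lemma rank_below_eq: "rank_below X b = (LEAST y. \<forall>z\<in>X. z < b \<longrightarrow> rank_below X z < y)"
proof -
  have "(LEAST y. \<forall>z\<in>X. z < b \<longrightarrow> cut (rank_below X) {(x, y). x < y} b z < y)
      = (LEAST y. \<forall>z\<in>X. z < b \<longrightarrow> rank_below X z < y)"
    by (rule arg_cong[where f = Least]) (auto simp: cut_def)
  moreover have "rank_below X b =
      (LEAST y. \<forall>z\<in>X. z < b \<longrightarrow> cut (rank_below X) {(x, y). x < y} b z < y)"
    unfolding rank_below_def by (rule wfrec[OF wf])
  ultimately show ?thesis by simp
qed

lemma rank_below_le: "rank_below X b \<le> b"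
proof (induction b rule: less_induct)
  case (less b)
  show ?case unfolding rank_below_eq[of X b]
    using less by (intro Least_le) (auto intro: le_less_trans)
qed

lemma rank_below_less: "z \<in> X \<Longrightarrow> z < b \<Longrightarrow> rank_below X z < rank_below X b"
proof -
  have "\<forall>z\<in>X. z < b \<longrightarrow> rank_below X z < rank_below X b"
    unfolding rank_below_eq[of X b]
    by (rule LeastI[of _ b]) (auto intro: le_less_trans rank_below_le)
  then show "z \<in> X \<Longrightarrow> z < b \<Longrightarrow> ?thesis" by blast
qed

lemma rank_below_le_iff: "rank_below X b \<le> y \<longleftrightarrow> (\<forall>z\<in>X. z < b \<longrightarrow> rank_below X z < y)"
proof
  assume "\<forall>z\<in>X. z < b \<longrightarrow> rank_below X z < y"
  then show "rank_below X b \<le> y" unfolding rank_below_eq[of X b] by (rule Least_le)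
qed (use rank_below_less in \<open>force intro: less_le_trans\<close>)

lemma rank_below_image: "rank_below X ` {z \<in> X. z < b} = {y. y < rank_below X b}"
proof (intro equalityI subsetI)
  fix y assume "y \<in> {y. y < rank_below X b}"
  then show "y \<in> rank_below X ` {z \<in> X. z < b}"
  proof (induction b rule: less_induct)
    case (less b)
    then have "\<not> rank_below X b \<le> y" by simp
    then obtain z where z: "z \<in> X" "z < b" "y \<le> rank_below X z"
      by (auto simp: rank_below_le_iff not_less)
    show ?case
    proof (cases "y = rank_below X z")
      case False
      then have "y \<in> rank_below X ` {x \<in> X. x < z}" using less.IH[OF z(2)] z by simp
      then show ?thesis using z by auto
    qed (use z in auto)
  qed
qed (auto intro: rank_below_less)

text \<open>Rigidity of well-orders: f fixes every point by induction, since moving a point down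
  contradicts monotonicity and moving it up contradicts surjectivity.\<close>

lemma initial_segment_iso_eq:
  fixes a b :: "'a::wellorder"
  assumes f: "bij_betw f {x. x < a} {x. x < b}" "strict_mono_on {x. x < a} f"
  shows "a = b"
proof -
  have fx: "f x = x" if "x < a" for x
    using that
  proof (induction x rule: less_induct)
    case (less x)
    have im: "f ` {x. x < a} = {x. x < b}" using f(1) by (simp add: bij_betw_def)
    have "\<not> f x < x"
    proof
      assume l: "f x < x"
      then have "f (f x) = f x" using less by force
      moreover have "f (f x) < f x" using f(2) l less.prems by (auto simp: strict_mono_on_def)
      ultimately show False by simp
    qed
    moreover have "\<not> x < f x"
    proof
      assume l: "x < f x"
      have "f x < b" using im less.prems by blast
      then obtain x' where x': "x' < a" "f x' = x" using im l by (metis (mono_tags) imageE mem_Collect_eq order_less_trans)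
      show False
      proof (cases x' x rule: linorder_cases)
        case less
        then show ?thesis using less.IH[OF less] x' by simp
      next
        case greater
        then have "f x < f x'" using f(2) x' less.prems by (auto simp: strict_mono_on_def)
        then show ?thesis using x' l by simp
      qed (use x' l in simp)
    qed
    ultimately show ?case by simp
  qed
  have "{x. x < a} = {x. x < b}" using f(1) fx by (force simp: bij_betw_def image_def)
  then show ?thesis by (metis less_irrefl mem_Collect_eq linorder_neqE)
qed

text \<open>\<open>rank_below X\<close> collapses X below b onto an initial segment. Its inverse is
  an isomorphism as \<open>otp\<close> asks for, and rigidity makes the length unique.\<close>

lemma otp_eq_rank_below:
  fixes X :: "'a::wellorder set"
  shows "otp (X \<inter> {x. x < b}) = rank_below X b"
proof -
  let ?Y = "X \<inter> {x. x < b}" and ?r = "rank_below X"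
  have Y: "{z \<in> X. z < b} = ?Y" by auto
  have r: "bij_betw ?r ?Y {y. y < ?r b}" "strict_mono_on ?Y ?r"
    using rank_below_image[of X b]
    by (auto simp: Y bij_betw_def strict_mono_on_def intro: rank_below_less
        intro!: linorder_inj_onI') (metis Y less_irrefl rank_below_less)+
  define g where "g = inv_into ?Y ?r"
  have g: "bij_betw g {y. y < ?r b} ?Y" unfolding g_def by (rule bij_betw_inv_into[OF r(1)])
  have rg: "?r (g y) = y" if "y < ?r b" for y
    using bij_betw_inv_into_right[OF r(1)] that by (simp add: g_def)
  have g_mono: "strict_mono_on {y. y < ?r b} g"
  proof (rule strict_mono_onI)
    fix x y assume xy: "x \<in> {y. y < ?r b}" "y \<in> {y. y < ?r b}" "x < y"
    then have "g x \<in> ?Y" "g y \<in> ?Y" using g by (auto simp: bij_betw_def)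
    then show "g x < g y" using r(2) rg xy
      by (metis linorder_neqE mem_Collect_eq order_less_asym strict_mono_onD)
  qed
  show ?thesis unfolding otp_def
  proof (rule the_equality)
    show "\<exists>f. bij_betw f {x. x < ?r b} ?Y \<and> strict_mono_on {x. x < ?r b} f"
      using g g_mono by blast
    fix a :: 'a assume "\<exists>f. bij_betw f {x. x < a} ?Y \<and> strict_mono_on {x. x < a} f"
    then obtain f where f: "bij_betw f {x. x < a} ?Y" "strict_mono_on {x. x < a} f" by blast
    have "bij_betw (?r \<circ> f) {x. x < a} {y. y < ?r b}" using f(1) r(1) by (rule bij_betw_trans)
    moreover have "strict_mono_on {x. x < a} (?r \<circ> f)"
      using f(2) r(2) bij_betwE[OF f(1)] by (simp add: strict_mono_on_def)
    ultimately show "a = ?r b" by (rule initial_segment_iso_eq)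
  qed
qed

lemma rank_below_const:
  assumes "a \<le> b" "X \<inter> {a..<b} = {}"
  shows "rank_below X b = rank_below X a"
proof -
  have "z < b \<longleftrightarrow> z < a" if "z \<in> X" for z using assms that by force
  then have "rank_below X b \<le> y \<longleftrightarrow> rank_below X a \<le> y" for y by (auto simp: rank_below_le_iff)
  then show ?thesis by (metis order_antisym order_refl)
qed

text \<open>The part of a set before \<theta> influences later ranks only through the rank at
  \<theta>.\<close>

lemma rank_below_glue:
  assumes "rank_below X \<theta> = rank_below Y \<theta>" "X \<inter> {\<theta>..<\<Delta>} = Y \<inter> {\<theta>..<\<Delta>}" "\<theta> \<le> \<xi>" "\<xi> \<le> \<Delta>"
  shows "rank_below X \<xi> = rank_below Y \<xi>"
  using assms(3,4)
proof (induction \<xi> rule: less_induct)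
  case (less \<xi>)
  have split: "rank_below Z \<xi> \<le> y \<longleftrightarrow> rank_below Z \<theta> \<le> y \<and> (\<forall>z\<in>Z \<inter> {\<theta>..<\<xi>}. rank_below Z z < y)" for Z y
    using less.prems(1) by (fastforce simp: rank_below_le_iff not_le)
  have "X \<inter> {\<theta>..<\<xi>} = Y \<inter> {\<theta>..<\<xi>}" using assms(2) less.prems by force
  moreover have "rank_below X z = rank_below Y z" if "z \<in> {\<theta>..<\<xi>}" for z
    using less that by auto
  ultimately have "rank_below X \<xi> \<le> y \<longleftrightarrow> rank_below Y \<xi> \<le> y" for y
    unfolding split assms(1) by (metis Int_iff)
  then show ?case by (metis order_antisym order_refl)
qed

text \<open>Here y is the successor of x, so x is the only element that can raise the rank between
  the two.\<close>

lemma rank_below_mem_iff: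
  assumes "x < y" "\<And>z. x < z \<Longrightarrow> y \<le> z"
  shows "x \<in> X \<longleftrightarrow> rank_below X x < rank_below X y"
proof
  assume "rank_below X x < rank_below X y"
  then have "X \<inter> {x..<y} \<noteq> {}" using rank_below_const[of x y X] assms(1) by force
  then show "x \<in> X" using assms(2) by (metis IntE all_not_in_conv atLeastLessThan_iff leD le_less)
qed (use assms rank_below_less in blast)

subsection \<open>Walks\<close>

definition walk_next :: "('a::wellorder \<Rightarrow> 'a set) \<Rightarrow> 'a \<Rightarrow> 'a \<Rightarrow> 'a" where
  "walk_next C \<beta> \<gamma> = (LEAST y. y \<in> C \<gamma> \<and> \<beta> \<le> y)"

context
  fixes C :: "'a::wellorder \<Rightarrow> 'a set"
  assumes Cseq: "C_sequence C"
begin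

lemma C_less: "x \<in> C \<gamma> \<Longrightarrow> x < \<gamma>"
  using Cseq by (auto simp: C_sequence_def)

lemma C_cofinal: "\<beta> < \<gamma> \<Longrightarrow> \<exists>y\<in>C \<gamma>. \<beta> \<le> y"
  using Cseq by (auto simp: C_sequence_def)

lemma C_closed: "\<alpha> < \<gamma> \<Longrightarrow> \<exists>x. x < \<alpha> \<Longrightarrow> \<forall>\<beta><\<alpha>. \<exists>y\<in>C \<gamma>. \<beta> < y \<and> y < \<alpha> \<Longrightarrow> \<alpha> \<in> C \<gamma>"
  using Cseq by (auto simp: C_sequence_def)

lemma walk_next:
  assumes "\<beta> < \<gamma>"
  shows "walk_next C \<beta> \<gamma> \<in> C \<gamma>" "\<beta> \<le> walk_next C \<beta> \<gamma>" "walk_next C \<beta> \<gamma> < \<gamma>"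
    "\<And>y. y \<in> C \<gamma> \<Longrightarrow> \<beta> \<le> y \<Longrightarrow> walk_next C \<beta> \<gamma> \<le> y"
proof -
  have "\<exists>y. y \<in> C \<gamma> \<and> \<beta> \<le> y" using C_cofinal[OF assms] by blast
  from LeastI_ex[OF this] show "walk_next C \<beta> \<gamma> \<in> C \<gamma>" "\<beta> \<le> walk_next C \<beta> \<gamma>"
    by (auto simp: walk_next_def)
  then show "walk_next C \<beta> \<gamma> < \<gamma>" by (simp add: C_less)
qed (auto simp: walk_next_def intro: Least_le)

lemma walk_next_eqI:
  assumes "\<beta> < \<gamma>" "y \<in> C \<gamma>" "\<beta> \<le> y" "C \<gamma> \<inter> {\<beta>..<y} = {}"
  shows "walk_next C \<beta> \<gamma> = y"
  using walk_next[OF assms(1)] assms by (force simp: order.order_iff_strict)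

lemma Tr_Suc: "\<beta> < \<gamma> \<Longrightarrow> Tr C \<beta> \<gamma> (Suc l) = Tr C \<beta> (walk_next C \<beta> \<gamma>) l"
  by (simp add: Tr_def funpow_Suc_right tr_step_def walk_next_def del: funpow.simps)

lemma Tr_0: "Tr C \<beta> \<gamma> 0 = \<gamma>"
  by (simp add: Tr_def)

lemma Tr_reaches: "\<beta> \<le> \<gamma> \<Longrightarrow> \<exists>l. Tr C \<beta> \<gamma> l = \<beta>"
proof (induction \<gamma> rule: less_induct)
  case (less \<gamma>)
  show ?case
  proof (cases "\<beta> = \<gamma>")
    case False
    then have "\<beta> < \<gamma>" using less.prems by simp
    then show ?thesis using less.IH[OF walk_next(3) walk_next(2)] Tr_Suc by metis
  qed (metis Tr_0)
qed

lemma rho0_refl [simp]: "rho0 C \<beta> \<beta> = []"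
proof -
  have "rho2 C \<beta> \<beta> = 0" unfolding rho2_def by (rule Least_eq_0) (simp add: Tr_0)
  then show ?thesis by (simp add: rho0_def)
qed

text \<open>Peeling off the first step turns iterated steps into a recursion along the decreasing
  walk. The later inductions on walks rest on this equation and not on \<open>Tr\<close>.\<close>

lemma rho0_rec:
  assumes "\<beta> < \<gamma>"
  shows "rho0 C \<beta> \<gamma> = rank_below (C \<gamma>) \<beta> # rho0 C \<beta> (walk_next C \<beta> \<gamma>)"
proof -
  obtain l where "Tr C \<beta> \<gamma> l = \<beta>" using Tr_reaches assms by (metis less_imp_le)
  then have "rho2 C \<beta> \<gamma> = Suc (LEAST l. Tr C \<beta> \<gamma> (Suc l) = \<beta>)"
    \<comment> \<open>Index 0 is excluded because the walk starts at \<gamma>, which differs from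
      \<beta>.\<close>
    unfolding rho2_def using assms by (intro Least_Suc) (auto simp: Tr_0)
  then have "rho2 C \<beta> \<gamma> = Suc (rho2 C \<beta> (walk_next C \<beta> \<gamma>))"
    by (simp add: Tr_Suc[OF assms] rho2_def)
  then show ?thesis unfolding rho0_def
    by (simp add: upt_conv_Cons map_Suc_upt[symmetric] Tr_0 Tr_Suc[OF assms] otp_eq_rank_below comp_def
        del: upt_Suc)
qed

lemma rho0_nonempty: "\<beta> < \<gamma> \<Longrightarrow> rho0 C \<beta> \<gamma> \<noteq> []"
  by (simp add: rho0_rec)

text \<open>No point of \<open>C \<gamma>\<close> separates \<beta> from \<delta>, so the walks to
  both take the same first step and record the same order type.\<close>

lemma rho0_gap:
  assumes "\<beta> \<le> \<delta>" "\<delta> < \<gamma>" "C \<gamma> \<inter> {\<beta>..<\<delta>} = {}"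
  shows "rho0 C \<beta> \<gamma> = rank_below (C \<gamma>) \<delta> # rho0 C \<beta> (walk_next C \<delta> \<gamma>)"
proof -
  have "walk_next C \<beta> \<gamma> = walk_next C \<delta> \<gamma>"
  proof (rule walk_next_eqI)
    show "C \<gamma> \<inter> {\<beta>..<walk_next C \<delta> \<gamma>} = {}"
      using assms(3) walk_next(4)[OF assms(2)] by (force simp: not_le[symmetric])
  qed (use assms walk_next[OF assms(2)] in auto)
  then show ?thesis using rho0_rec[of \<beta> \<gamma>] rank_below_const[OF assms(1,3)] assms by simp
qed

text \<open>No \<open>C \<alpha>\<close> with \<alpha> above \<delta> accumulates at \<delta>, so
  each set used on the walk to \<delta> has a bound below \<delta> for its points there. Beyond the
  largest of these finitely many bounds the walk to \<xi> follows the walk to \<delta> until it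
  arrives there.\<close>

lemma rho0_through_A:
  assumes "\<delta> \<in> A_set C" "\<delta> < \<alpha>"
  shows "\<exists>\<epsilon><\<delta>. \<forall>\<xi>. \<epsilon> < \<xi> \<longrightarrow> \<xi> < \<delta> \<longrightarrow> rho0 C \<xi> \<alpha> = rho0 C \<delta> \<alpha> @ rho0 C \<xi> \<delta>"
  using assms(2)
proof (induction \<alpha> rule: less_induct)
  case (less \<alpha>)
  have lim: "\<exists>x. x < \<delta>" using assms(1) by (auto simp: A_set_def lim_ord_def)
  have "\<not> (\<forall>\<beta><\<delta>. \<exists>\<gamma>\<in>C \<alpha>. \<beta> < \<gamma> \<and> \<gamma> < \<delta>)"
    using C_closed[OF less.prems lim] assms(1) less.prems lim by (auto simp: A_set_def acc_set_def)
  then obtain \<epsilon> where \<epsilon>: "\<epsilon> < \<delta>" "\<And>\<gamma>. \<gamma> \<in> C \<alpha> \<Longrightarrow> \<epsilon> < \<gamma> \<Longrightarrow> \<not> \<gamma> < \<delta>" by blast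
  let ?\<alpha>' = "walk_next C \<delta> \<alpha>"
  have 1: "rho0 C \<xi> \<alpha> = rank_below (C \<alpha>) \<delta> # rho0 C \<xi> ?\<alpha>'" if "\<epsilon> < \<xi>" "\<xi> \<le> \<delta>" for \<xi>
    using \<epsilon>(2) that less.prems by (intro rho0_gap) fastforce+
  show ?case
  proof (cases "?\<alpha>' = \<delta>")
    case True
    then show ?thesis using 1 \<epsilon>(1) by (intro exI[of _ \<epsilon>]) (simp add: 1[OF \<epsilon>(1)])
  next
    case False
    then have "\<delta> < ?\<alpha>'" using walk_next(2)[OF less.prems] by simp
    then obtain \<epsilon>' where \<epsilon>': "\<epsilon>' < \<delta>"
      "\<And>\<xi>. \<epsilon>' < \<xi> \<Longrightarrow> \<xi> < \<delta> \<Longrightarrow> rho0 C \<xi> ?\<alpha>' = rho0 C \<delta> ?\<alpha>' @ rho0 C \<xi> \<delta>"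
      using less.IH[OF walk_next(3)[OF less.prems]] by blast
    show ?thesis
      using 1 \<epsilon>(1) \<epsilon>' by (intro exI[of _ "max \<epsilon> \<epsilon>'"]) (simp add: 1[OF \<epsilon>(1)])
  qed
qed

text \<open>\<open>C \<delta>\<close> has a gap directly below its non-accumulation point \<gamma>,
  so walks from \<delta> to points of this gap step to \<gamma> first.\<close>

lemma rho0_through_nacc:
  assumes "\<gamma> \<in> nacc_set (C \<delta>)" "\<exists>x. x < \<gamma>"
  shows "\<exists>\<epsilon><\<gamma>. \<forall>\<xi>. \<epsilon> < \<xi> \<longrightarrow> \<xi> \<le> \<gamma> \<longrightarrow> rho0 C \<xi> \<delta> = rank_below (C \<delta>) \<gamma> # rho0 C \<xi> \<gamma>"
proof -
  have \<gamma>: "\<gamma> \<in> C \<delta>" "\<gamma> < \<delta>" using assms C_less by (auto simp: nacc_set_def)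
  obtain \<epsilon> where \<epsilon>: "\<epsilon> < \<gamma>" "\<And>x. x \<in> C \<delta> \<Longrightarrow> \<epsilon> < x \<Longrightarrow> \<not> x < \<gamma>"
    using assms \<gamma> by (auto simp: nacc_set_def acc_set_def)
  have "walk_next C \<gamma> \<delta> = \<gamma>" using \<gamma> by (intro walk_next_eqI) auto
  then have "rho0 C \<xi> \<delta> = rank_below (C \<delta>) \<gamma> # rho0 C \<xi> \<gamma>" if "\<epsilon> < \<xi>" "\<xi> \<le> \<gamma>" for \<xi>
    using rho0_gap[of \<xi> \<gamma> \<delta>] \<gamma> \<epsilon>(2) that by fastforce
  then show ?thesis using \<epsilon>(1) by blast
qed

text \<open>The stations of the walk before \<gamma> lie above \<gamma>, where \<open>R_set\<close>
  bounds the order types. This keeps the data of patterns below \<gamma>.\<close>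

lemma rho0_less_R:
  assumes "\<gamma> \<in> R_set C" "\<gamma> < \<alpha>" "i \<in> set (rho0 C \<gamma> \<alpha>)"
  shows "i < \<gamma>"
  using assms(2,3)
proof (induction \<alpha> rule: less_induct)
  case (less \<alpha>)
  have "rank_below (C \<alpha>) \<gamma> < \<gamma>"
    using assms(1) less.prems(1) by (auto simp: R_set_def otp_eq_rank_below)
  moreover have "walk_next C \<gamma> \<alpha> = \<gamma> \<or> \<gamma> < walk_next C \<gamma> \<alpha>"
    using walk_next(2)[OF less.prems(1)] by auto
  ultimately show ?case
    using less.prems less.IH[OF walk_next(3)[OF less.prems(1)]] by (auto simp: rho0_rec)
qed

text \<open>The head of \<open>rho0 C \<xi> \<alpha>\<close> is the rank of \<xi> in
  \<open>C \<alpha>\<close>, and the ranks at a point and at its successor decide membership of the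
  point. The limit assumption keeps the successor below \<Delta>.\<close>

lemma rho0_agree_imp_C_agree:
  assumes eq: "\<And>\<xi>. \<theta> \<le> \<xi> \<Longrightarrow> \<xi> < \<Delta> \<Longrightarrow> rho0 C \<xi> \<alpha> = rho0 C \<xi> \<beta>"
    and "\<Delta> \<le> \<alpha>" "\<Delta> \<le> \<beta>" and lim: "lim_ord \<Delta>"
  shows "C \<alpha> \<inter> {\<theta>..<\<Delta>} = C \<beta> \<inter> {\<theta>..<\<Delta>}"
proof -
  have r: "rank_below (C \<alpha>) \<xi> = rank_below (C \<beta>) \<xi>" if "\<theta> \<le> \<xi>" "\<xi> < \<Delta>" for \<xi>
    using eq[OF that] that assms(2,3) by (simp add: rho0_rec)
  have "x \<in> C \<alpha> \<longleftrightarrow> x \<in> C \<beta>" if x: "\<theta> \<le> x" "x < \<Delta>" for x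
  proof -
    define y where "y = (LEAST y. x < y)"
    obtain z where "x < z" "z < \<Delta>" using lim x by (auto simp: lim_ord_def)
    then have y: "x < y" "\<And>z. x < z \<Longrightarrow> y \<le> z" unfolding y_def by (auto intro: LeastI Least_le)
    then have "y < \<Delta>" using \<open>x < z\<close> \<open>z < \<Delta>\<close> by (meson le_less_trans)
    then show ?thesis
      using rank_below_mem_iff[OF y] r[of x] r[of y] x y(1) by simp
  qed
  then show ?thesis by auto
qed

text \<open>Induction along the walk from \<alpha>. \<open>C \<alpha>\<close> and
  \<open>C \<beta>\<close> agree on a tail below \<Delta>, so membership in \<open>V_set\<close>
  excludes that just one of the walks is already at \<Delta>. Otherwise both sets accumulate at
  \<Delta>, and both walks step there, or both leave a gap, and the question passes to the next
  stations.\<close>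

lemma rho0_agree_at_V:
  assumes V: "\<Delta> \<in> V_set C" and "\<theta> < \<Delta>" "\<Delta> \<le> \<alpha>" "\<Delta> \<le> \<beta>"
    and eq: "\<And>\<xi>. \<theta> \<le> \<xi> \<Longrightarrow> \<xi> < \<Delta> \<Longrightarrow> rho0 C \<xi> \<alpha> = rho0 C \<xi> \<beta>"
  shows "rho0 C \<Delta> \<alpha> = rho0 C \<Delta> \<beta>"
  using assms(2-5)
proof (induction \<alpha> arbitrary: \<beta> \<theta> rule: less_induct)
  case (less \<alpha>)
  have lim: "lim_ord \<Delta>" using V by (simp add: V_set_def)
  note agree = rho0_agree_imp_C_agree[OF less.prems(4,2,3) lim]
  have Vneq: "C \<Delta> \<inter> {\<theta>..<\<Delta>} \<noteq> C \<zeta> \<inter> {\<theta>..<\<Delta>}" if "\<Delta> < \<zeta>" for \<zeta>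
    using V less.prems(1) that by (simp add: V_set_def)
  have "\<alpha> = \<Delta> \<longleftrightarrow> \<beta> = \<Delta>"
    using Vneq[of \<alpha>] Vneq[of \<beta>] agree less.prems(2,3) by (auto simp: order.order_iff_strict)
  show ?case
  proof (cases "\<alpha> = \<Delta>")
    case True
    then show ?thesis using \<open>\<alpha> = \<Delta> \<longleftrightarrow> \<beta> = \<Delta>\<close> by simp
  next
    case False
    then have gr: "\<Delta> < \<alpha>" "\<Delta> < \<beta>" using less.prems \<open>\<alpha> = \<Delta> \<longleftrightarrow> \<beta> = \<Delta>\<close> by auto
    have "rank_below (C \<alpha>) \<theta> = rank_below (C \<beta>) \<theta>"
      using less.prems(4)[of \<theta>] less.prems(1-3) by (simp add: rho0_rec)
    then have rank: "rank_below (C \<alpha>) \<Delta> = rank_below (C \<beta>) \<Delta>"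
      by (rule rank_below_glue[OF _ agree]) (use less.prems(1) in auto)
    show ?thesis
    proof (cases "\<forall>b<\<Delta>. \<exists>y\<in>C \<alpha>. b < y \<and> y < \<Delta>")
      case True
      have "\<forall>b<\<Delta>. \<exists>y\<in>C \<beta>. b < y \<and> y < \<Delta>"
      proof (intro allI impI)
        fix b assume "b < \<Delta>"
        then obtain y where "y \<in> C \<alpha>" "max b \<theta> < y" "y < \<Delta>" using True less.prems(1) by (metis max_less_iff_conj)
        then show "\<exists>y\<in>C \<beta>. b < y \<and> y < \<Delta>" using agree by (metis IntD1 IntI atLeastLessThan_iff less_imp_le max_less_iff_conj)
      qed
      then have "\<Delta> \<in> C \<alpha>" "\<Delta> \<in> C \<beta>" using True gr less.prems(1) by (auto intro: C_closed)
      then have "walk_next C \<Delta> \<alpha> = \<Delta>" "walk_next C \<Delta> \<beta> = \<Delta>" using gr by (auto intro: walk_next_eqI)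
      then show ?thesis using rho0_rec gr rank by simp
    next
      case False
      then obtain b where b: "b < \<Delta>" "\<And>y. y \<in> C \<alpha> \<Longrightarrow> b < y \<Longrightarrow> \<not> y < \<Delta>" by blast
      \<comment> \<open>Beyond both \<theta> and the bound b, both sets have a gap up to \<Delta>
        and \<open>rho0_gap\<close> applies.\<close>
      obtain \<theta>' where \<theta>': "max b \<theta> < \<theta>'" "\<theta>' < \<Delta>"
        using lim b(1) less.prems(1) unfolding lim_ord_def by (metis max_less_iff_conj)
      have gap: "C \<alpha> \<inter> {\<xi>..<\<Delta>} = {}" "C \<beta> \<inter> {\<xi>..<\<Delta>} = {}" if "\<theta>' \<le> \<xi>" for \<xi>
      proof -
        show "C \<alpha> \<inter> {\<xi>..<\<Delta>} = {}" using b(2) \<theta>'(1) that by fastforce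
        then have "C \<alpha> \<inter> {\<theta>..<\<Delta>} \<inter> {\<xi>..<\<Delta>} = {}" by blast
        moreover have "{\<xi>..<\<Delta>} \<subseteq> {\<theta>..<\<Delta>}" using \<theta>'(1) that by auto
        ultimately show "C \<beta> \<inter> {\<xi>..<\<Delta>} = {}" using agree by blast
      qed
      have "rho0 C \<Delta> (walk_next C \<Delta> \<alpha>) = rho0 C \<Delta> (walk_next C \<Delta> \<beta>)"
      proof (rule less.IH[OF walk_next(3)[OF gr(1)] \<theta>'(2) walk_next(2)[OF gr(1)] walk_next(2)[OF gr(2)]])
        fix \<xi> assume \<xi>: "\<theta>' \<le> \<xi>" "\<xi> < \<Delta>"
        then have "rho0 C \<xi> \<alpha> = rho0 C \<xi> \<beta>" using \<theta>' by (intro less.prems(4)) auto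
        then show "rho0 C \<xi> (walk_next C \<Delta> \<alpha>) = rho0 C \<xi> (walk_next C \<Delta> \<beta>)"
          using rho0_gap[OF _ gr(1) gap(1)] rho0_gap[OF _ gr(2) gap(2)] \<xi> by simp
      qed
      then show ?thesis using rho0_rec gr rank by simp
    qed
  qed
qed

text \<open>The sets \<open>C\<^bsub>\<alpha>\<^esub> \<inter> \<eta>\<close> for \<open>\<alpha>\<close> on the walk from \<open>\<delta>\<close> to \<open>\<eta>\<close> determine \<open>\<rho>\<^bsub>0\<delta>\<^esub>\<close> below \<open>\<eta>\<close>.\<close>
primrec rho0_from :: "'a \<Rightarrow> 'a set list \<Rightarrow> 'a \<Rightarrow> 'a list" where
  "rho0_from \<eta> [] \<xi> = rho0 C \<xi> \<eta>"
| "rho0_from \<eta> (X # Xs) \<xi> = rank_below X \<xi> #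
     (if X \<inter> {\<xi>..<\<eta>} = {} then rho0_from \<eta> Xs \<xi> else rho0 C \<xi> (LEAST y. y \<in> X \<and> \<xi> \<le> y))"

text \<open>The next station on the way to \<xi> is either the one taken on the way to \<eta> or a
  point of the recorded trace. Weak coherence leaves few traces, hence few such lists, which bounds
  the levels of the tree.\<close>

lemma rho0_eq_rho0_from:
  assumes "\<eta> \<le> \<alpha>"
  shows "\<exists>Xs\<in>lists {C \<delta> \<inter> {x. x < \<eta>} | \<delta>. True}. \<forall>\<xi><\<eta>. rho0 C \<xi> \<alpha> = rho0_from \<eta> Xs \<xi>"
  using assms
proof (induction \<alpha> rule: less_induct)
  case (less \<alpha>)
  show ?case
  proof (cases "\<eta> = \<alpha>")
    case True
    then show ?thesis by (intro bexI[of _ "[]"]) auto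
  next
    case False
    then have gr: "\<eta> < \<alpha>" using less.prems by simp
    obtain Xs where Xs: "Xs\<in>lists {C \<delta> \<inter> {x. x < \<eta>} | \<delta>. True}"
      "\<And>\<xi>. \<xi> < \<eta> \<Longrightarrow> rho0 C \<xi> (walk_next C \<eta> \<alpha>) = rho0_from \<eta> Xs \<xi>"
      using less.IH[OF walk_next(3)[OF gr] walk_next(2)[OF gr]] by blast
    let ?X = "C \<alpha> \<inter> {x. x < \<eta>}"
    have "rho0 C \<xi> \<alpha> = rho0_from \<eta> (?X # Xs) \<xi>" if \<xi>: "\<xi> < \<eta>" for \<xi>
    proof -
      have r: "rank_below ?X \<xi> = rank_below (C \<alpha>) \<xi>"
      proof -
        have "?X \<inter> {x. x < \<xi>} = C \<alpha> \<inter> {x. x < \<xi>}" using \<xi> by auto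
        then show ?thesis by (metis otp_eq_rank_below)
      qed
      show ?thesis
      proof (cases "?X \<inter> {\<xi>..<\<eta>} = {}")
        case True
        then have "C \<alpha> \<inter> {\<xi>..<\<eta>} = {}" by auto
        then show ?thesis using rho0_gap[OF _ gr] Xs(2)[OF \<xi>] \<xi> True r rank_below_const[of \<xi> \<eta> "C \<alpha>"] by simp
      next
        case False
        then obtain y where "y \<in> C \<alpha>" "\<xi> \<le> y" "y < \<eta>" by auto
        then have y: "\<exists>y. y \<in> ?X \<and> \<xi> \<le> y" by auto
        let ?y = "LEAST y. y \<in> ?X \<and> \<xi> \<le> y"
        have "?y \<in> ?X" "\<xi> \<le> ?y" "\<And>y. y \<in> ?X \<Longrightarrow> \<xi> \<le> y \<Longrightarrow> ?y \<le> y"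
          using LeastI_ex[OF y] by (auto intro: Least_le)
        then have "walk_next C \<xi> \<alpha> = ?y"
          using \<xi> gr by (intro walk_next_eqI) (auto, force)
        then show ?thesis using rho0_rec[of \<xi> \<alpha>] \<xi> gr False r by simp
      qed
    qed
    then show ?thesis using Xs(1) by (intro bexI[of _ "?X # Xs"]) auto
  qed
qed

end

subsection \<open>Clubs and stationary sets\<close>

text \<open>For a regular cardinal \<open>\<kappa>\<close> this says that a set has fewer than \<open>\<kappa>\<close> elements.\<close>
definition small :: "'a::wellorder itself \<Rightarrow> 'b set \<Rightarrow> bool" where
  "small _ A \<longleftrightarrow> (\<forall>f :: 'b \<Rightarrow> 'a. \<exists>b. \<forall>x\<in>A. f x < b)"

lemma smallD: "small (t :: 'a::wellorder itself) A \<Longrightarrow> \<exists>b. \<forall>x\<in>A. (f x :: 'a) < b"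
  by (simp add: small_def)

lemma small_subset: "small t A \<Longrightarrow> B \<subseteq> A \<Longrightarrow> small t B"
  unfolding small_def by blast

lemma small_image: "small (t :: 'a::wellorder itself) A \<Longrightarrow> small t (f ` A)"
proof -
  assume A: "small t A"
  show ?thesis unfolding small_def
  proof
    fix g :: "_ \<Rightarrow> 'a"
    show "\<exists>b. \<forall>x\<in>f ` A. g x < b" using smallD[OF A, of "g \<circ> f"] by auto
  qed
qed

lemma small_UN: "small (t :: 'a::wellorder itself) A \<Longrightarrow> (\<And>a. a \<in> A \<Longrightarrow> small t (B a)) \<Longrightarrow> small t (\<Union>a\<in>A. B a)"
proof -
  assume A: "small t A" and B: "\<And>a. a \<in> A \<Longrightarrow> small t (B a)"
  show ?thesis unfolding small_def
  proof
    fix f :: "_ \<Rightarrow> 'a"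
    have "\<forall>a\<in>A. \<exists>b. \<forall>x\<in>B a. f x < b" using smallD[OF B, of _ f] by blast
    then obtain b where b: "\<And>a x. a \<in> A \<Longrightarrow> x \<in> B a \<Longrightarrow> f x < b a" by metis
    obtain c where "\<forall>a\<in>A. b a < c" using smallD[OF A, of b] by blast
    then show "\<exists>c. \<forall>x\<in>\<Union>(B ` A). f x < c" using b by (intro exI[of _ c]) force
  qed
qed

lemma small_Times: "small t A \<Longrightarrow> small t B \<Longrightarrow> small t (A \<times> B)"
proof -
  assume A: "small t A" and B: "small t B"
  have "A \<times> B = (\<Union>a\<in>A. Pair a ` B)" by auto
  then show ?thesis using small_UN[OF A small_image[OF B]] by simp
qed

definition stationary :: "'a::wellorder set \<Rightarrow> bool" where
  "stationary B \<longleftrightarrow> (\<forall>D. club D \<longrightarrow> B \<inter> D \<noteq> {})"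

lemma club_unbounded: "club D \<Longrightarrow> \<exists>x\<in>D. \<beta> \<le> x"
  by (simp add: club_def)

lemma club_closed: "club D \<Longrightarrow> \<exists>x. x < \<alpha> \<Longrightarrow> \<forall>\<beta><\<alpha>. \<exists>\<gamma>\<in>D. \<beta> < \<gamma> \<and> \<gamma> < \<alpha> \<Longrightarrow> \<alpha> \<in> D"
  by (simp add: club_def)

locale regular_uncountable =
  fixes \<kappa> :: "'a::wellorder itself"
  assumes uncountable: "\<not> countable (UNIV :: 'a set)"
    and cardinal: "\<And>a::'a. {x. x < a} \<prec> (UNIV :: 'a set)"
    and regular: "\<And>X::'a set. (\<And>x. \<exists>y\<in>X. x \<le> y) \<Longrightarrow> X \<approx> (UNIV :: 'a set)"
begin

abbreviation sm :: "'b set \<Rightarrow> bool" where "sm \<equiv> small \<kappa>"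

text \<open>With a largest element, the whole type would be an infinite initial segment plus one
  point, hence of the same size as that segment.\<close>

lemma no_top: "\<exists>y. (x::'a) < y"
proof (rule ccontr)
  assume "\<not> ?thesis"
  then have U: "UNIV = insert x {y. y < x}" by (auto simp: not_less order.order_iff_strict)
  have "infinite (UNIV :: 'a set)" using uncountable countable_finite by blast
  then have "infinite {y. y < x}" using U by (metis finite_insert)
  then have "insert x {y. y < x} \<approx> {y. y < x}" by (simp add: infinite_insert_eqpoll)
  then show False using cardinal[of x] U by (metis eqpoll_sym lesspoll_eq_trans lesspoll_not_refl eq_lesspoll_trans)
qed

lemma lesspoll_bounded: "X \<prec> (UNIV :: 'a set) \<Longrightarrow> \<exists>b::'a. \<forall>x\<in>X. x < b"
proof (rule ccontr)
  assume "X \<prec> (UNIV :: 'a set)" "\<nexists>b. \<forall>x\<in>X. x < b"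
  then have "X \<approx> (UNIV :: 'a set)" by (intro regular) (auto simp: not_less)
  then show False using \<open>X \<prec> UNIV\<close> by (simp add: lesspoll_def)
qed

lemma sm_lesspoll: "X \<prec> (UNIV :: 'a set) \<Longrightarrow> sm X"
  unfolding small_def
proof
  fix f :: "_ \<Rightarrow> 'a" assume "X \<prec> (UNIV :: 'a set)"
  then have "f ` X \<prec> (UNIV :: 'a set)" using image_lepoll lesspoll_trans1 by blast
  from lesspoll_bounded[OF this] show "\<exists>b. \<forall>x\<in>X. f x < b" by blast
qed

lemma sm_countable: "countable X \<Longrightarrow> sm X"
proof (rule sm_lesspoll)
  assume X: "countable X"
  have "X \<lesssim> (UNIV :: nat set)" using X by (auto simp: lepoll_def countable_def)
  also have "(UNIV :: nat set) \<lesssim> (UNIV :: 'a set)"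
    using uncountable infinite_le_lepoll uncountable_infinite by blast
  finally have "X \<lesssim> (UNIV :: 'a set)" .
  moreover have "\<not> X \<approx> (UNIV :: 'a set)"
    using X uncountable countable_eqpoll eqpoll_sym by blast
  ultimately show "X \<prec> (UNIV :: 'a set)" by (simp add: lesspoll_def)
qed

lemma sm_finite: "finite X \<Longrightarrow> sm X"
  by (simp add: countable_finite sm_countable)

lemma sm_lessThan: "sm {x::'a. x < b}"
  by (rule sm_lesspoll[OF cardinal])

lemma sm_atMost: "sm {x::'a. x \<le> b}"
proof -
  have "{x. x \<le> b} = insert b {x. x < b}" by auto
  also have "\<dots> = (\<Union>A\<in>{{b}, {x. x < b}}. A)" by auto
  also have "sm \<dots>" by (rule small_UN) (auto intro: sm_finite sm_lessThan)
  finally show ?thesis .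
qed

text \<open>Lists are split by length; the countable union is harmless because uncountability and
  regularity make countable sets small.\<close>

lemma sm_lists:
  assumes A: "sm A"
  shows "sm (lists A)"
proof -
  have l: "sm {xs \<in> lists A. length xs = m}" for m
  proof (induction m)
    case (Suc m)
    have "{xs \<in> lists A. length xs = Suc m} = (\<Union>a\<in>A. (#) a ` {xs \<in> lists A. length xs = m})"
      by (auto simp: length_Suc_conv) blast
    then show ?case using small_UN[OF A small_image[OF Suc]] by simp
  qed (auto intro: sm_finite)
  have "sm (\<Union>m. {xs \<in> lists A. length xs = m})" by (intro small_UN sm_countable l) simp
  also have "(\<Union>m. {xs \<in> lists A. length xs = m}) = lists A" by auto
  finally show ?thesis .
qed

lemma not_sm_UNIV: "\<not> sm (UNIV :: 'a set)"
proof
  assume "sm (UNIV :: 'a set)"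
  from smallD[OF this, of "\<lambda>x. x"] show False by blast
qed

lemma eqpoll_not_sm: "X \<approx> (UNIV :: 'a set) \<Longrightarrow> \<not> sm X"
proof
  assume "X \<approx> (UNIV :: 'a set)" "sm X"
  then obtain f where "f ` X = (UNIV :: 'a set)" by (auto simp: eqpoll_def bij_betw_def)
  then show False using small_image[OF \<open>sm X\<close>, of f] not_sm_UNIV by simp
qed

lemma unbounded_eqpoll_imp:
  assumes "X \<approx> (UNIV :: 'a set)" "inj_on f X"
  shows "\<exists>x\<in>X. (b::'a) < f x"
proof (rule ccontr)
  assume "\<not> ?thesis"
  then have "f ` X \<subseteq> {x. x \<le> b}" by (auto simp: not_less)
  then have "sm (inv_into X f ` f ` X)" using sm_atMost small_subset small_image by metis
  then show False using eqpoll_not_sm[OF assms(1)] inv_into_image_cancel[OF assms(2)] by simp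
qed

text \<open>Iterating H from \<beta> gives an increasing sequence of length omega, bounded because
  countable sets are small. Its supremum z is a limit closed under G.\<close>

lemma club_closure_points: "club {\<gamma>::'a. lim_ord \<gamma> \<and> (\<forall>b<\<gamma>. G b < \<gamma>)}"
proof -
  let ?D = "{\<gamma>::'a. lim_ord \<gamma> \<and> (\<forall>b<\<gamma>. G b < \<gamma>)}"
  have "\<forall>x. \<exists>y>x. \<forall>b\<le>x. G b < y"
  proof
    fix x
    obtain y where "\<forall>b\<in>{b. b \<le> x}. max x (G b) < y"
      using smallD[OF sm_atMost[of x], of "\<lambda>b. max x (G b)"] by blast
    then show "\<exists>y>x. \<forall>b\<le>x. G b < y" by (intro exI[of _ y]) auto
  qed
  then obtain H where H: "\<And>x. x < H x" "\<And>x b. b \<le> x \<Longrightarrow> G b < H x" by metis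
  have "\<exists>\<gamma>\<in>?D. \<beta> \<le> \<gamma>" for \<beta>
  proof -
    define s where "s k = (H ^^ k) \<beta>" for k
    have s: "s 0 = \<beta>" "s (Suc k) = H (s k)" for k by (auto simp: s_def)
    have ex: "\<exists>z. \<forall>k. s k < z" using smallD[OF sm_countable[of UNIV], of s] by auto
    define z where "z = (LEAST z. \<forall>k. s k < z)"
    have z: "s k < z" for k using LeastI_ex[OF ex] by (simp add: z_def)
    have below: "\<exists>k. b \<le> s k" if "b < z" for b
      using not_less_Least[OF that[unfolded z_def]] by (auto simp: not_less)
    have "lim_ord z" unfolding lim_ord_def
      using z below s(2) H(1) by (metis le_less_trans)
    moreover have "G b < z" if "b < z" for b
      using below[OF that] z s(2) H(2) by (metis order_less_trans)
    ultimately show ?thesis using z[of 0] s(1) by auto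
  qed
  moreover have "\<alpha> \<in> ?D" if "\<exists>x. x < \<alpha>" "\<forall>\<beta><\<alpha>. \<exists>\<gamma>\<in>?D. \<beta> < \<gamma> \<and> \<gamma> < \<alpha>" for \<alpha>
    using that by (auto simp: lim_ord_def intro: less_trans) (meson less_trans)+
  ultimately show ?thesis unfolding club_def by blast
qed

lemma next_in_club: "club D \<Longrightarrow> \<exists>y\<in>D. (b::'a) < y"
proof -
  assume D: "club D"
  obtain c where "b < c" using no_top by blast
  moreover obtain y where "y \<in> D" "c \<le> y" using club_unbounded[OF D] by blast
  ultimately show ?thesis using less_le_trans by blast
qed

text \<open>\<open>G b\<close> exceeds a point beyond b of every club with index at most b, so
  closure points of G are limits of each club with a smaller index.\<close>

lemma club_diagonal:
  assumes "\<And>i::'a. club (D i)"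
  shows "\<exists>D'. club D' \<and> (\<forall>\<gamma>\<in>D'. lim_ord \<gamma> \<and> (\<forall>i<\<gamma>. \<gamma> \<in> D i))"
proof -
  have "\<forall>i b. \<exists>y\<in>D i. b < y" using next_in_club assms by blast
  then obtain nx where nx: "\<And>i b. nx i b \<in> D i" "\<And>i b. b < nx i b" by metis
  have "\<forall>b. \<exists>y. \<forall>i\<in>{i. i \<le> b}. nx i b < y"
    using smallD[OF sm_atMost, of _ "\<lambda>i. nx i b" for b] by blast
  then obtain G where G: "\<And>b i. i \<le> b \<Longrightarrow> nx i b < G b" by (metis mem_Collect_eq)
  let ?D = "{\<gamma>::'a. lim_ord \<gamma> \<and> (\<forall>b<\<gamma>. G b < \<gamma>)}"
  have "\<gamma> \<in> D i" if \<gamma>: "\<gamma> \<in> ?D" "i < \<gamma>" for \<gamma> i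
  proof (rule club_closed[OF assms])
    show "\<forall>\<beta><\<gamma>. \<exists>x\<in>D i. \<beta> < x \<and> x < \<gamma>"
    proof (intro allI impI)
      fix \<beta> assume "\<beta> < \<gamma>"
      then have m: "max \<beta> i < \<gamma>" using \<gamma> by simp
      have "nx i (max \<beta> i) < G (max \<beta> i)" by (simp add: G)
      also have "\<dots> < \<gamma>" using \<gamma> m by blast
      finally show "\<exists>x\<in>D i. \<beta> < x \<and> x < \<gamma>"
        using nx(1)[of i "max \<beta> i"] nx(2)[of "max \<beta> i" i] by auto
    qed
  qed (use \<gamma> in blast)
  then show ?thesis using club_closure_points[of G] by (intro exI[of _ ?D]) auto
qed

lemma club_Inter_sm:
  fixes D :: "'b \<Rightarrow> 'a set"
  assumes "sm I" "\<And>i. i \<in> I \<Longrightarrow> club (D i)"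
  shows "club (\<Inter>i\<in>I. D i)"
proof -
  have "\<forall>i\<in>I. \<forall>b. \<exists>y\<in>D i. b < y" using next_in_club assms(2) by blast
  then obtain nx where nx: "\<And>i b. i \<in> I \<Longrightarrow> nx i b \<in> D i" "\<And>i b. i \<in> I \<Longrightarrow> b < nx i b" by metis
  have "\<forall>b. \<exists>y. \<forall>i\<in>I. nx i b < y"
    using smallD[OF assms(1), of "\<lambda>i. nx i b" for b] by blast
  then obtain G where G: "\<And>b i. i \<in> I \<Longrightarrow> nx i b < G b" by metis
  let ?D = "{\<gamma>::'a. lim_ord \<gamma> \<and> (\<forall>b<\<gamma>. G b < \<gamma>)}"
  have "?D \<subseteq> (\<Inter>i\<in>I. D i)"
  proof (intro subsetI INT_I)
    fix \<gamma> i assume \<gamma>: "\<gamma> \<in> ?D" and i: "i \<in> I"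
    show "\<gamma> \<in> D i"
    proof (rule club_closed[OF assms(2)[OF i]])
      show "\<exists>x. x < \<gamma>" using \<gamma> by (simp add: lim_ord_def)
      show "\<forall>\<beta><\<gamma>. \<exists>x\<in>D i. \<beta> < x \<and> x < \<gamma>"
        using nx[OF i] G[OF i] \<gamma> by (metis (mono_tags, lifting) mem_Collect_eq order_less_trans)
    qed
  qed
  then have "\<exists>x\<in>(\<Inter>i\<in>I. D i). \<beta> \<le> x" for \<beta>
    using club_unbounded[OF club_closure_points[of G], of \<beta>] by blast
  moreover have "\<alpha> \<in> (\<Inter>i\<in>I. D i)"
    if "\<exists>x. x < \<alpha>" "\<forall>\<beta><\<alpha>. \<exists>\<gamma>\<in>(\<Inter>i\<in>I. D i). \<beta> < \<gamma> \<and> \<gamma> < \<alpha>" for \<alpha>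
  proof
    fix i assume "i \<in> I"
    then show "\<alpha> \<in> D i" using that by (intro club_closed[OF assms(2)]) blast+
  qed
  ultimately show ?thesis unfolding club_def by blast
qed

lemma club_Int: "club D \<Longrightarrow> club D' \<Longrightarrow> club (D \<inter> (D' :: 'a set))"
  using club_Inter_sm[OF sm_finite, of "{D, D'}" "\<lambda>X. X"] by auto

lemma club_greaterThan: "club {x::'a. b < x}"
  unfolding club_def
proof (intro conjI allI impI)
  fix \<beta> :: 'a
  obtain y where "max \<beta> b < y" using no_top by blast
  then show "\<exists>\<gamma>\<in>{x. b < x}. \<beta> \<le> \<gamma>" by (intro bexI[of _ y]) auto
qed (auto intro: less_trans)

lemma stationary_Int_club: "stationary B \<Longrightarrow> club D \<Longrightarrow> stationary (B \<inter> (D :: 'a set))"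
  unfolding stationary_def by (simp add: Int_assoc club_Int)

lemma stationary_unbounded: "stationary B \<Longrightarrow> \<exists>x\<in>B. (b::'a) < x"
  using club_greaterThan[of b] unfolding stationary_def by blast

text \<open>Fodor's lemma in bounded form. Otherwise each bound has a club witnessing
  nonstationarity, and a point of B in a diagonal club lies in the club belonging to its own
  value.\<close>

lemma pressing_down:
  assumes B: "stationary B" and f: "\<And>\<delta>. \<delta> \<in> B \<Longrightarrow> f \<delta> < (\<delta>::'a)"
  shows "\<exists>\<epsilon>. stationary {\<delta> \<in> B. f \<delta> \<le> \<epsilon>}"
proof (rule ccontr)
  assume "\<not> ?thesis"
  then have "\<forall>\<epsilon>. \<exists>D. club D \<and> {\<delta> \<in> B. f \<delta> \<le> \<epsilon>} \<inter> D = {}" by (simp add: stationary_def)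
  from choice[OF this] obtain D where
    D: "\<And>\<epsilon>. club (D \<epsilon>)" "\<And>\<epsilon>. {\<delta> \<in> B. f \<delta> \<le> \<epsilon>} \<inter> D \<epsilon> = {}" by blast
  obtain D' where D': "club D'" "\<And>\<gamma> i. \<gamma> \<in> D' \<Longrightarrow> i < \<gamma> \<Longrightarrow> \<gamma> \<in> D i"
    using club_diagonal[of D, OF D(1)] by blast
  obtain \<delta> where "\<delta> \<in> B" "\<delta> \<in> D'" using B D'(1) unfolding stationary_def by blast
  then have "\<delta> \<in> {\<delta>' \<in> B. f \<delta>' \<le> f \<delta>} \<inter> D (f \<delta>)" using f D'(2) by auto
  then show False using D(2) by blast
qed

end

subsection \<open>Long walks\<close>

lemma finite_uniform_bound:
  fixes \<delta> :: "'a::linorder"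
  assumes "finite X" "\<exists>e. e < \<delta>" "\<And>x. x \<in> X \<Longrightarrow> \<exists>\<epsilon><\<delta>. P x \<epsilon>"
    and mono: "\<And>x \<epsilon> \<epsilon>'. x \<in> X \<Longrightarrow> P x \<epsilon> \<Longrightarrow> \<epsilon> \<le> \<epsilon>' \<Longrightarrow> P x \<epsilon>'"
  shows "\<exists>\<epsilon><\<delta>. \<forall>x\<in>X. P x \<epsilon>"
  using assms
proof (induction rule: finite_induct)
  case (insert x X)
  then obtain \<epsilon> \<epsilon>' where e: "\<epsilon> < \<delta>" "\<forall>x\<in>X. P x \<epsilon>" "\<epsilon>' < \<delta>" "P x \<epsilon>'"
    by (metis insertI1 insertI2)
  show ?case
  proof (intro exI[of _ "max \<epsilon> \<epsilon>'"] conjI ballI)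
    show "max \<epsilon> \<epsilon>' < \<delta>" using e by simp
    fix y assume "y \<in> insert x X"
    then show "P y (max \<epsilon> \<epsilon>')"
      using e insert.prems(3)[of y \<epsilon>] insert.prems(3)[of y \<epsilon>'] by (metis insertE insertI1 insertI2 max.cobounded1 max.cobounded2)
  qed
qed auto

lemma rho0_tree_node: "x \<in> rho0_tree C \<Longrightarrow> \<exists>\<alpha>\<ge>fst x. \<forall>\<xi><fst x. snd x \<xi> = rho0 C \<xi> \<alpha>"
  by (auto simp: rho0_tree_def restr_def)

lemma restr_in_rho0_tree:
  assumes "x \<in> rho0_tree C" "\<eta> \<le> fst x"
  shows "restr (snd x) \<eta> \<in> rho0_tree C"
proof -
  obtain \<alpha> where "fst x \<le> \<alpha>" "\<And>\<xi>. \<xi> < fst x \<Longrightarrow> snd x \<xi> = rho0 C \<xi> \<alpha>"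
    using rho0_tree_node[OF assms(1)] by blast
  then have "restr (snd x) \<eta> = restr (\<lambda>\<xi>. rho0 C \<xi> \<alpha>) \<eta>" "\<eta> \<le> \<alpha>"
    using assms(2) by (auto simp: restr_def fun_eq_iff)
  then show ?thesis by (auto simp: rho0_tree_def)
qed

text \<open>Stationarity of \<open>A_set C\<close> is not a hypothesis of the theorem; it is derived
  from guessing in \<open>guess_imp_stationary\<close>.\<close>

locale guessing_walks = regular_uncountable \<kappa>
  for \<kappa> :: "'a::wellorder itself" +
  fixes C :: "'a \<Rightarrow> 'a set"
  assumes Cseq: "C_sequence C" and wc: "weakly_coherent C"
    and A_stationary: "stationary (A_set C)"
begin

lemma sm_level: "sm {x \<in> rho0_tree C. fst x = \<eta>}"
proof -
  let ?X = "{C \<delta> \<inter> {x. x < \<eta>} | \<delta>. True}"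
  have "{x \<in> rho0_tree C. fst x = \<eta>} \<subseteq> (\<lambda>Xs. restr (rho0_from C \<eta> Xs) \<eta>) ` lists ?X"
  proof
    fix x assume "x \<in> {x \<in> rho0_tree C. fst x = \<eta>}"
    then obtain \<alpha> where \<alpha>: "x = restr (\<lambda>\<xi>. rho0 C \<xi> \<alpha>) \<eta>" "\<eta> \<le> \<alpha>"
      by (auto simp: rho0_tree_def restr_def)
    obtain Xs where "Xs \<in> lists ?X" "\<forall>\<xi><\<eta>. rho0 C \<xi> \<alpha> = rho0_from C \<eta> Xs \<xi>"
      using rho0_eq_rho0_from[OF Cseq \<alpha>(2)] by blast
    then show "x \<in> (\<lambda>Xs. restr (rho0_from C \<eta> Xs) \<eta>) ` lists ?X"
      using \<alpha>(1) by (intro image_eqI[of _ _ Xs]) (auto simp: restr_def fun_eq_iff)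
  qed
  moreover have "sm ?X" using wc unfolding weakly_coherent_def by (intro sm_lesspoll) blast
  ultimately show ?thesis by (meson sm_lists small_image small_subset)
qed

lemma node_through_A:
  assumes "\<delta> \<in> A_set C" "x \<in> rho0_tree C" "\<delta> < fst x"
  shows "\<exists>\<epsilon><\<delta>. \<forall>\<xi>. \<epsilon> < \<xi> \<longrightarrow> \<xi> < \<delta> \<longrightarrow> snd x \<xi> = snd x \<delta> @ rho0 C \<xi> \<delta>"
proof -
  obtain \<alpha> where \<alpha>: "fst x \<le> \<alpha>" "\<And>\<xi>. \<xi> < fst x \<Longrightarrow> snd x \<xi> = rho0 C \<xi> \<alpha>"
    using rho0_tree_node[OF assms(2)] by blast
  then obtain \<epsilon> where "\<epsilon> < \<delta>"
    "\<And>\<xi>. \<epsilon> < \<xi> \<Longrightarrow> \<xi> < \<delta> \<Longrightarrow> rho0 C \<xi> \<alpha> = rho0 C \<delta> \<alpha> @ rho0 C \<xi> \<delta>"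
    using rho0_through_A[OF Cseq assms(1), of \<alpha>] assms(3) by (meson less_le_trans)
  then show ?thesis using \<alpha>(2) assms(3) by (metis less_trans)
qed

lemma nodes_through_A:
  assumes "\<delta> \<in> A_set C" "finite X" "X \<subseteq> rho0_tree C" "\<And>x. x \<in> X \<Longrightarrow> \<delta> < fst x"
  shows "\<exists>\<epsilon><\<delta>. \<forall>x\<in>X. \<forall>\<xi>. \<epsilon> < \<xi> \<longrightarrow> \<xi> < \<delta> \<longrightarrow> snd x \<xi> = snd x \<delta> @ rho0 C \<xi> \<delta>"
proof (rule finite_uniform_bound)
  show "\<exists>e. e < \<delta>" using assms(1) by (auto simp: A_set_def lim_ord_def)
  show "\<exists>\<epsilon><\<delta>. \<forall>\<xi>. \<epsilon> < \<xi> \<longrightarrow> \<xi> < \<delta> \<longrightarrow> snd x \<xi> = snd x \<delta> @ rho0 C \<xi> \<delta>" if "x \<in> X" for x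
    using that assms node_through_A by blast
qed (use assms in auto)

text \<open>Points of \<Gamma> are replaced by points \<zeta> of \<open>A_set C\<close> through
  which their walks pass. Pressing down makes this uniform above \<epsilon>, so a walk of length m
  from such a \<zeta> is prolonged by the nonempty walk from \<open>d \<zeta>\<close> to
  \<zeta>.\<close>

lemma rho0_long:
  assumes "stationary B" "\<And>b. \<exists>d\<in>\<Gamma>. b < d"
  shows "\<exists>\<delta>\<in>B. \<exists>d\<in>\<Gamma>. \<delta> < d \<and> m \<le> length (rho0 C \<delta> d)"
  using assms
proof (induction m arbitrary: B \<Gamma>)
  case 0
  obtain \<delta> where "\<delta> \<in> B" using stationary_unbounded[OF "0"(1)] by blast
  then show ?case using "0"(2)[of \<delta>] by auto
next
  case (Suc m)
  obtain d where d: "\<And>\<zeta>. d \<zeta> \<in> \<Gamma>" "\<And>\<zeta>. \<zeta> < d \<zeta>" using Suc.prems(2) by metis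
  have "\<forall>\<zeta>\<in>A_set C. \<exists>\<epsilon><\<zeta>. \<forall>\<xi>. \<epsilon> < \<xi> \<longrightarrow> \<xi> < \<zeta> \<longrightarrow> rho0 C \<xi> (d \<zeta>) = rho0 C \<zeta> (d \<zeta>) @ rho0 C \<xi> \<zeta>"
    using rho0_through_A[OF Cseq _ d(2)] by blast
  then obtain f where f: "\<And>\<zeta>. \<zeta> \<in> A_set C \<Longrightarrow> f \<zeta> < \<zeta>" and
    f': "\<And>\<zeta> \<xi>. \<zeta> \<in> A_set C \<Longrightarrow> f \<zeta> < \<xi> \<Longrightarrow> \<xi> < \<zeta> \<Longrightarrow> rho0 C \<xi> (d \<zeta>) = rho0 C \<zeta> (d \<zeta>) @ rho0 C \<xi> \<zeta>"
    by metis
  obtain \<epsilon> where \<epsilon>: "stationary {\<zeta> \<in> A_set C. f \<zeta> \<le> \<epsilon>}"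
    using pressing_down[OF A_stationary f] by blast
  obtain \<delta> \<zeta> where 1: "\<delta> \<in> B" "\<epsilon> < \<delta>" "\<zeta> \<in> A_set C" "f \<zeta> \<le> \<epsilon>" "\<delta> < \<zeta>" "m \<le> length (rho0 C \<delta> \<zeta>)"
    using Suc.IH[OF stationary_Int_club[OF Suc.prems(1) club_greaterThan[of \<epsilon>]] stationary_unbounded[OF \<epsilon>]]
    by blast
  have "rho0 C \<delta> (d \<zeta>) = rho0 C \<zeta> (d \<zeta>) @ rho0 C \<delta> \<zeta>" using f' 1 by force
  moreover have "rho0 C \<zeta> (d \<zeta>) \<noteq> []" using rho0_nonempty[OF Cseq d(2)] .
  ultimately have "Suc m \<le> length (rho0 C \<delta> (d \<zeta>))"
    using 1 by (cases "rho0 C \<zeta> (d \<zeta>)") auto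
  then show ?case using 1 d by (meson less_trans)
qed

text \<open>For each m the failures in \<open>A_set C\<close> are nonstationary:
  \<open>rho0_long\<close> would give a long walk from a pressed-down \<zeta> to a failing point,
  and the walks of all nodes of \<open>\<sigma> \<zeta>\<close> run through \<zeta>. The parameter
  \<open>adm\<close> carries along a property that the tuples have over an interval.\<close>

lemma long_tuples:
  assumes S: "\<And>\<zeta>. \<exists>\<sigma>\<in>S. set \<sigma> \<subseteq> rho0_tree C \<and> (\<forall>x\<in>set \<sigma>. \<zeta> < fst x) \<and>
      (\<forall>\<delta>\<in>A_set C. \<epsilon>\<^sub>0 < \<delta> \<longrightarrow> \<delta> < \<zeta> \<longrightarrow> adm \<delta> \<sigma>)"
  shows "\<exists>D. club D \<and> (\<forall>\<delta>\<in>D \<inter> A_set C. \<forall>m. \<exists>\<sigma>\<in>S. (\<forall>x\<in>set \<sigma>. \<delta> < fst x) \<and> adm \<delta> \<sigma> \<and>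
      (\<forall>x\<in>set \<sigma>. m \<le> length (snd x \<delta>)))"
proof -
  let ?P = "\<lambda>\<delta> m. \<exists>\<sigma>\<in>S. (\<forall>x\<in>set \<sigma>. \<delta> < fst x) \<and> adm \<delta> \<sigma> \<and> (\<forall>x\<in>set \<sigma>. m \<le> length (snd x \<delta>))"
  obtain \<sigma> where \<sigma>: "\<And>\<zeta>. \<sigma> \<zeta> \<in> S" "\<And>\<zeta>. set (\<sigma> \<zeta>) \<subseteq> rho0_tree C" "\<And>\<zeta> x. x \<in> set (\<sigma> \<zeta>) \<Longrightarrow> \<zeta> < fst x"
    "\<And>\<zeta> \<delta>. \<delta> \<in> A_set C \<Longrightarrow> \<epsilon>\<^sub>0 < \<delta> \<Longrightarrow> \<delta> < \<zeta> \<Longrightarrow> adm \<delta> (\<sigma> \<zeta>)"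
    using S by metis
  have "\<forall>\<zeta>\<in>A_set C. \<exists>\<epsilon><\<zeta>. \<forall>x\<in>set (\<sigma> \<zeta>). \<forall>\<xi>. \<epsilon> < \<xi> \<longrightarrow> \<xi> < \<zeta> \<longrightarrow> snd x \<xi> = snd x \<zeta> @ rho0 C \<xi> \<zeta>"
    using nodes_through_A[OF _ _ \<sigma>(2,3)] by blast
  then obtain f where f: "\<And>\<zeta>. \<zeta> \<in> A_set C \<Longrightarrow> f \<zeta> < \<zeta>" and
    f': "\<And>\<zeta> x \<xi>. \<zeta> \<in> A_set C \<Longrightarrow> x \<in> set (\<sigma> \<zeta>) \<Longrightarrow> f \<zeta> < \<xi> \<Longrightarrow> \<xi> < \<zeta> \<Longrightarrow> snd x \<xi> = snd x \<zeta> @ rho0 C \<xi> \<zeta>"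
    by metis
  obtain \<epsilon> where \<epsilon>: "stationary {\<zeta> \<in> A_set C. f \<zeta> \<le> \<epsilon>}"
    using pressing_down[OF A_stationary f] by blast
  have "\<exists>D. club D \<and> {\<delta> \<in> A_set C. \<not> ?P \<delta> m} \<inter> D = {}" for m
  proof (rule ccontr)
    assume "\<not> ?thesis"
    then have "stationary {\<delta> \<in> A_set C. \<not> ?P \<delta> m}" by (simp add: stationary_def)
    from rho0_long[OF stationary_Int_club[OF this club_greaterThan[of "max \<epsilon> \<epsilon>\<^sub>0"]] stationary_unbounded[OF \<epsilon>], of m]
    obtain \<delta> \<zeta> where 1: "\<delta> \<in> A_set C" "\<not> ?P \<delta> m" "\<epsilon> < \<delta>" "\<epsilon>\<^sub>0 < \<delta>"
      "\<zeta> \<in> A_set C" "f \<zeta> \<le> \<epsilon>" "\<delta> < \<zeta>" "m \<le> length (rho0 C \<delta> \<zeta>)"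
      by (elim bexE) auto
    have "m \<le> length (snd x \<delta>)" "\<delta> < fst x" if "x \<in> set (\<sigma> \<zeta>)" for x
      using f'[OF 1(5) that, of \<delta>] \<sigma>(3)[OF that] 1 by auto
    then have "?P \<delta> m" using \<sigma>(1) \<sigma>(4)[OF 1(1,4,7)] by blast
    then show False using 1(2) by simp
  qed
  then have "\<forall>m. \<exists>D. club D \<and> {\<delta> \<in> A_set C. \<not> ?P \<delta> m} \<inter> D = {}" by blast
  from choice[OF this] obtain D where
    D: "\<And>m. club (D m)" "\<And>m. {\<delta> \<in> A_set C. \<not> ?P \<delta> m} \<inter> D m = {}" by blast
  have "club (\<Inter>m. D m)" using D(1) by (intro club_Inter_sm sm_countable) auto
  then show ?thesis using D(2) by blast
qed

end

subsection \<open>The colouring\<close>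

definition last_below :: "'a::wellorder set \<Rightarrow> 'a \<Rightarrow> 'a" where
  "last_below E \<beta> = (THE e. e \<in> E \<and> e < \<beta> \<and> (\<forall>e'\<in>E. e' < \<beta> \<longrightarrow> e' \<le> e))"

text \<open>Without a greatest point of E below \<beta>, the supremum z of the points there would be
  a limit of E, hence in E, hence below \<beta> as \<beta> is not in E. The point
  \<open>e\<^sub>0\<close> makes the set nonempty.\<close>

lemma last_below:
  assumes E: "club E" and "e\<^sub>0 \<in> E" "e\<^sub>0 < \<beta>" "\<beta> \<notin> E"
  shows "last_below E \<beta> \<in> E" "last_below E \<beta> < \<beta>" "e\<^sub>0 \<le> last_below E \<beta>"
proof -
  let ?P = "\<lambda>e. e \<in> E \<and> e < \<beta> \<and> (\<forall>e'\<in>E. e' < \<beta> \<longrightarrow> e' \<le> e)"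
  have "\<exists>e. ?P e"
  proof (rule ccontr)
    assume no: "\<not> ?thesis"
    define z where "z = (LEAST z. \<forall>e\<in>E. e < \<beta> \<longrightarrow> e < z)"
    have "\<forall>e\<in>E. e < \<beta> \<longrightarrow> e < z" unfolding z_def by (rule LeastI[of _ \<beta>]) simp
    then have z: "\<And>e. e \<in> E \<Longrightarrow> e < \<beta> \<Longrightarrow> e < z" by blast
    have "z \<le> \<beta>" unfolding z_def by (rule Least_le) simp
    have "z \<in> E"
    proof (rule club_closed[OF E])
      show "\<forall>b<z. \<exists>e\<in>E. b < e \<and> e < z"
      proof (intro allI impI)
        fix b assume "b < z"
        then have "\<not> (\<forall>e\<in>E. e < \<beta> \<longrightarrow> e < b)" unfolding z_def by (rule not_less_Least)
        then obtain e where e: "e \<in> E" "e < \<beta>" "b \<le> e" by (auto simp: not_less)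
        then obtain e' where "e' \<in> E" "e' < \<beta>" "e < e'" using no not_less by blast
        then show "\<exists>e\<in>E. b < e \<and> e < z" using z e by (meson le_less_trans)
      qed
    qed (use z assms in blast)
    then have "z < \<beta>" using \<open>z \<le> \<beta>\<close> assms(4) by (auto simp: order.order_iff_strict)
    then show False using z[OF \<open>z \<in> E\<close>] by simp
  qed
  then have "\<exists>!e. ?P e" by (metis order_antisym)
  from theI'[OF this] show "last_below E \<beta> \<in> E" "last_below E \<beta> < \<beta>" "e\<^sub>0 \<le> last_below E \<beta>"
    using assms by (auto simp: last_below_def)
qed

definition node_colour :: "nat \<Rightarrow> 'a::wellorder set \<Rightarrow> ('a \<Rightarrow> nat \<times> 'm list) \<Rightarrow> 'a node \<Rightarrow> 'm" where
  "node_colour n E L t = word_colour n (map L (snd t (last_below E (fst t))))"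

lemma Delta_eq:
  assumes "\<Delta> < fst x" "\<Delta> < fst y" "\<And>\<xi>. \<xi> < \<Delta> \<Longrightarrow> snd x \<xi> = snd y \<xi>" "snd x \<Delta> \<noteq> snd y \<Delta>"
  shows "Delta x y = \<Delta>"
proof -
  have "(LEAST \<xi>. \<xi> < fst x \<and> \<xi> < fst y \<and> snd x \<xi> \<noteq> snd y \<xi>) = \<Delta>"
  proof (rule Least_equality)
    fix \<xi> assume "\<xi> < fst x \<and> \<xi> < fst y \<and> snd x \<xi> \<noteq> snd y \<xi>"
    then show "\<Delta> \<le> \<xi>" using assms(3)[of \<xi>] by (auto simp: not_less[symmetric])
  qed (use assms in simp)
  then show ?thesis using assms by (auto simp: Delta_def)
qed

text \<open>The guessing hypothesis in the form needed: L attaches a letter and a list of n colours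
  to an order type. The list is fixed before \<delta>, but one \<delta> serves all letters, since
  the letter is found only from tuples above \<delta>.\<close>

definition guess :: "('a::wellorder \<Rightarrow> 'a set) \<Rightarrow> nat \<Rightarrow> ('a \<Rightarrow> nat \<times> 'm list) \<Rightarrow> bool" where
  "guess C n L \<longleftrightarrow> (\<forall>D cs. club D \<longrightarrow> length cs = n \<longrightarrow> (\<exists>\<delta>\<in>A_set C. \<forall>N. \<forall>\<beta><\<delta>.
     \<exists>\<gamma>\<in>nacc_set (C \<delta>) \<inter> D \<inter> R_set C. \<beta> < \<gamma> \<and> L (otp (C \<delta> \<inter> {x. x < \<gamma>})) = (N, cs)))"

lemma guess_mem_club:
  assumes Cseq: "C_sequence C" and "club D" "\<delta> \<in> A_set C" "\<And>\<beta>. \<beta> < \<delta> \<Longrightarrow> \<exists>\<gamma>\<in>nacc_set (C \<delta>) \<inter> D. \<beta> < \<gamma>"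
  shows "\<delta> \<in> D"
proof (rule club_closed[OF assms(2)])
  show "\<exists>x. x < \<delta>" using assms(3) by (auto simp: A_set_def lim_ord_def)
  show "\<forall>\<beta><\<delta>. \<exists>\<gamma>\<in>D. \<beta> < \<gamma> \<and> \<gamma> < \<delta>"
  proof (intro allI impI)
    fix \<beta> assume "\<beta> < \<delta>"
    then obtain \<gamma> where "\<gamma> \<in> nacc_set (C \<delta>) \<inter> D" "\<beta> < \<gamma>" using assms(4) by blast
    then show "\<exists>\<gamma>\<in>D. \<beta> < \<gamma> \<and> \<gamma> < \<delta>" using C_less[OF Cseq] by (auto simp: nacc_set_def)
  qed
qed

lemma guess_imp_stationary:
  fixes C :: "'a::wellorder \<Rightarrow> 'a set"
  assumes "C_sequence C" "guess C n L"
  shows "stationary (A_set C)"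
  unfolding stationary_def
proof (intro allI impI)
  fix D :: "'a set" assume "club D"
  \<comment> \<open>Any colour list does; only the existence of \<delta> matters.\<close>
  moreover have "length (replicate n undefined) = n" by simp
  ultimately obtain \<delta> where "\<delta> \<in> A_set C" "\<And>\<beta>. \<beta> < \<delta> \<Longrightarrow> \<exists>\<gamma>\<in>nacc_set (C \<delta>) \<inter> D. \<beta> < \<gamma>"
    using assms(2) unfolding guess_def by blast
  then show "A_set C \<inter> D \<noteq> {}" using guess_mem_club[OF assms(1) \<open>club D\<close>] by blast
qed

text \<open>Equal colours are demanded of coordinates that the colouring might confuse.\<close>
definition admissible :: "'m list \<Rightarrow> 'a \<Rightarrow> 'a node list \<Rightarrow> bool" where
  "admissible cs \<delta> \<sigma> \<longleftrightarrow> (\<forall>k<length cs. \<forall>k'<length cs.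
     length (snd (\<sigma> ! k) \<delta>) = length (snd (\<sigma> ! k') \<delta>) \<longrightarrow> cs ! k = cs ! k')"

section \<open>Recurring patterns and splitting walks\<close>

context guessing_walks
begin

text \<open>A pattern \<open>(\<eta>, ss, Ws)\<close> records everything about tuples whose walks pass through \<open>\<gamma>\<close> except \<open>\<gamma>\<close>
  itself, so two points realising the same pattern yield tuples that differ only as \<open>\<rho>\<^sub>0(\<cdot>, \<gamma>)\<close> does.\<close>
definition pattern_points ::
  "'a node list set \<Rightarrow> 'a set \<Rightarrow> 'a \<times> 'a node list list \<times> 'a list list list \<Rightarrow> 'a set" where
  "pattern_points S E p = {\<gamma> \<in> E. \<exists>ys\<in>lists S.
     map (map (\<lambda>x. restr (snd x) (fst p))) ys = fst (snd p) \<and> map (map (\<lambda>x. snd x \<gamma>)) ys = snd (snd p) \<and>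
     (\<forall>\<sigma>\<in>set ys. \<forall>x\<in>set \<sigma>. \<gamma> < fst x \<and>
        (\<forall>\<xi>. fst p \<le> \<xi> \<longrightarrow> \<xi> < \<gamma> \<longrightarrow> snd x \<xi> = snd x \<gamma> @ rho0 C \<xi> \<gamma>))}"

definition patterns_below :: "'a \<Rightarrow> ('a \<times> 'a node list list \<times> 'a list list list) set" where
  "patterns_below b = (\<Union>\<eta>\<in>{\<eta>. \<eta> < b}. {\<eta>} \<times> lists (lists {x \<in> rho0_tree C. fst x = \<eta>}) \<times>
     lists (lists (lists {x. x < b})))"

lemma sm_patterns_below: "sm (patterns_below b)"
  unfolding patterns_below_def
  by (intro small_UN small_Times sm_lists sm_level sm_lessThan sm_finite) auto

text \<open>If no point beyond \<gamma> realised p, the bound \<open>f p\<close> would exceed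
  \<gamma>. But \<open>f p\<close> is below \<open>G b\<close>, where G exists because
  \<open>patterns_below b\<close> is small, and \<gamma> is closed under G.\<close>

lemma pattern_points_reflect:
  "\<exists>D. club D \<and> (\<forall>\<gamma>\<in>D. \<forall>b<\<gamma>. \<forall>p\<in>patterns_below b. \<gamma> \<in> pattern_points S E p \<longrightarrow>
     (\<exists>\<gamma>'\<in>pattern_points S E p. \<gamma> < \<gamma>'))"
proof -
  let ?Z = "pattern_points S E"
  define f where "f p = (SOME b. \<forall>x\<in>?Z p. x < b)" for p
  have f: "x < f p" if "\<forall>x\<in>?Z p. x < b" "x \<in> ?Z p" for p b x
    unfolding f_def using someI[of "\<lambda>b. \<forall>x\<in>?Z p. x < b", OF that(1)] that(2) by blast
  have "\<forall>b. \<exists>y. \<forall>p\<in>patterns_below b. f p < y" using smallD[OF sm_patterns_below, of _ f] by blast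
  then obtain G where G: "\<And>b p. p \<in> patterns_below b \<Longrightarrow> f p < G b" by metis
  let ?D = "{\<gamma>. lim_ord \<gamma> \<and> (\<forall>b<\<gamma>. G b < \<gamma>)}"
  have "\<exists>\<gamma>'\<in>?Z p. \<gamma> < \<gamma>'" if "\<gamma> \<in> ?D" "b < \<gamma>" "p \<in> patterns_below b" "\<gamma> \<in> ?Z p" for \<gamma> b p
  proof (rule ccontr)
    assume "\<not> ?thesis"
    moreover obtain y where "\<gamma> < y" using no_top by blast
    ultimately have "\<gamma> < f p" using that(4) by (intro f[of p y]) (auto simp: not_less intro: le_less_trans)
    also have "\<dots> < G b" using G that by blast
    also have "\<dots> < \<gamma>" using that by blast
    finally show False .
  qed
  then show ?thesis using club_closure_points[of G] by blast
qed

text \<open>Both clauses of the partition relation are instances: a constant list cs for the first,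
  arbitrary colours on tuples with pairwise different walk lengths for the second. The hypothesis
  \<open>adm\<close> covers both.\<close>

proposition tuples_realise_colours:
  assumes E: "club E" "E \<subseteq> V_set C" and guess: "guess C n L" and n: "0 < n"
    and S: "S \<subseteq> ntuples (rho0_tree C) n" "rapid S" and cs: "length cs = n"
    and adm: "\<And>\<zeta>. \<exists>\<sigma>\<in>S. (\<forall>x\<in>set \<sigma>. \<zeta> < fst x) \<and>
      (\<forall>\<delta>\<in>A_set C. \<epsilon>\<^sub>0 < \<delta> \<longrightarrow> \<delta> < \<zeta> \<longrightarrow> admissible cs \<delta> \<sigma>)"
  shows "\<exists>xs\<in>S. \<exists>ys\<in>S. good_pair (node_colour n E L) n 1 ((!) cs) xs ys"
proof -
  have S_T: "\<sigma> \<in> S \<Longrightarrow> set \<sigma> \<subseteq> rho0_tree C" and S_n: "\<sigma> \<in> S \<Longrightarrow> length \<sigma> = n" for \<sigma>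
    using S(1) by (auto simp: ntuples_def)
  have "\<exists>D. club D \<and> (\<forall>\<delta>\<in>D \<inter> A_set C. \<forall>m. \<exists>\<sigma>\<in>S. (\<forall>x\<in>set \<sigma>. \<delta> < fst x) \<and> admissible cs \<delta> \<sigma> \<and>
      (\<forall>x\<in>set \<sigma>. m \<le> length (snd x \<delta>)))"
    by (rule long_tuples[of S \<epsilon>\<^sub>0]) (use adm S_T in meson)
  then obtain D\<^sub>1 where D\<^sub>1: "club D\<^sub>1" and
    long: "\<And>\<delta> m. \<delta> \<in> D\<^sub>1 \<Longrightarrow> \<delta> \<in> A_set C \<Longrightarrow> \<exists>\<sigma>\<in>S. (\<forall>x\<in>set \<sigma>. \<delta> < fst x) \<and> admissible cs \<delta> \<sigma> \<and>
      (\<forall>x\<in>set \<sigma>. m \<le> length (snd x \<delta>))"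
    by blast
  obtain D\<^sub>2 where D\<^sub>2: "club D\<^sub>2" and
    reflect: "\<And>\<gamma> b p. \<gamma> \<in> D\<^sub>2 \<Longrightarrow> b < \<gamma> \<Longrightarrow> p \<in> patterns_below b \<Longrightarrow> \<gamma> \<in> pattern_points S E p \<Longrightarrow>
      \<exists>\<gamma>'\<in>pattern_points S E p. \<gamma> < \<gamma>'"
    using pattern_points_reflect[of S E] by blast
  obtain nx where nx: "\<And>b. nx b \<in> E" "\<And>b. b < nx b" using next_in_club[OF E(1)] by metis
  let ?D\<^sub>3 = "{\<gamma>. lim_ord \<gamma> \<and> (\<forall>b<\<gamma>. nx b < \<gamma>)}"
  \<comment> \<open>\<open>D\<^sub>1\<close> provides long walks down to \<delta>,
    \<open>D\<^sub>2\<close> lets patterns at \<gamma> recur, and the last set makes \<gamma> a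
    limit of points of E.\<close>
  define D where "D = D\<^sub>1 \<inter> D\<^sub>2 \<inter> ?D\<^sub>3"
  have D: "club D" unfolding D_def by (intro club_Int D\<^sub>1 D\<^sub>2 club_closure_points)
  obtain \<delta> where \<delta>: "\<delta> \<in> A_set C" and
    hit: "\<And>N \<beta>. \<beta> < \<delta> \<Longrightarrow> \<exists>\<gamma>\<in>nacc_set (C \<delta>) \<inter> D \<inter> R_set C.
       \<beta> < \<gamma> \<and> L (otp (C \<delta> \<inter> {x. x < \<gamma>})) = (N, cs)"
    using guess D cs unfolding guess_def by blast
  have "\<delta> \<in> D" using hit by (intro guess_mem_club[OF Cseq D \<delta>]) blast
  then have "\<delta> \<in> D\<^sub>1" by (simp add: D_def)

  let ?h = "\<lambda>w. map fst (map L w)"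
  define good where "good \<sigma> \<longleftrightarrow> \<sigma> \<in> S \<and> (\<forall>x\<in>set \<sigma>. \<delta> < fst x) \<and> admissible cs \<delta> \<sigma>" for \<sigma>
  let ?word = "\<lambda>\<sigma>. map (\<lambda>x. ?h (snd x \<delta>)) \<sigma>"
  \<comment> \<open>The words of good tuples escape every finite set because walks to \<delta> get
    arbitrarily long, so \<open>sel_among\<close> applies.\<close>
  have "\<exists>N Q. finite Q \<and> Q \<subseteq> ?word ` {\<sigma>. good \<sigma>} \<and> (\<forall>u. sel n N u \<in> Q)"
  proof (rule sel_among)
    show "length \<tau> = n" if "\<tau> \<in> ?word ` {\<sigma>. good \<sigma>}" for \<tau>
      using that S_n by (auto simp: good_def)
    fix B :: "nat list set" assume B: "finite B"
    obtain \<sigma> where \<sigma>: "good \<sigma>" "\<forall>x\<in>set \<sigma>. Suc (\<Sum>w\<in>B. length w) \<le> length (snd x \<delta>)"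
      using long[OF \<open>\<delta> \<in> D\<^sub>1\<close> \<delta>] unfolding good_def by blast
    have "set (?word \<sigma>) \<inter> B = {}"
    proof (rule ccontr)
      assume "set (?word \<sigma>) \<inter> B \<noteq> {}"
      then obtain x where x: "x \<in> set \<sigma>" "?h (snd x \<delta>) \<in> B" by auto
      then have "length (?h (snd x \<delta>)) \<le> (\<Sum>w\<in>B. length w)" using B by (intro member_le_sum) auto
      then show False using \<sigma>(2) x(1) by fastforce
    qed
    then show "\<exists>\<tau>\<in>?word ` {\<sigma>. good \<sigma>}. set \<tau> \<inter> B = {}" using \<sigma>(1) by blast
  qed
  then obtain N Q where Q: "finite Q" "Q \<subseteq> ?word ` {\<sigma>. good \<sigma>}" "\<And>u. sel n N u \<in> Q" by blast
  \<comment> \<open>Which tuple is read at N depends on the rest of the walk, still unknown here.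
    All finitely many candidates are taken along and reflected as one pattern.\<close>
  obtain Y where Y: "finite Y" "Y \<subseteq> {\<sigma>. good \<sigma>}" "?word ` Y = Q"
    using finite_subset_image[OF Q(1,2)] by blast
  obtain ys where ys: "set ys = Y" using finite_list[OF Y(1)] by blast
  define X where "X = (\<Union>\<sigma>\<in>Y. set \<sigma>)"
  have X: "finite X" "X \<subseteq> rho0_tree C" "\<And>x. x \<in> X \<Longrightarrow> \<delta> < fst x"
    using Y S_T by (auto simp: X_def good_def)
  obtain \<epsilon>\<^sub>1 where \<epsilon>\<^sub>1: "\<epsilon>\<^sub>1 < \<delta>" "\<And>x \<xi>. x \<in> X \<Longrightarrow> \<epsilon>\<^sub>1 < \<xi> \<Longrightarrow> \<xi> < \<delta> \<Longrightarrow> snd x \<xi> = snd x \<delta> @ rho0 C \<xi> \<delta>"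
    using nodes_through_A[OF \<delta> X] by blast
  define i where "i \<gamma> = rank_below (C \<delta>) \<gamma>" for \<gamma>
  obtain \<gamma> where \<gamma>: "\<gamma> \<in> nacc_set (C \<delta>)" "\<gamma> \<in> D" "\<gamma> \<in> R_set C" "\<epsilon>\<^sub>1 < \<gamma>" "L (i \<gamma>) = (N, cs)"
    using hit[OF \<epsilon>\<^sub>1(1), of N] by (auto simp: otp_eq_rank_below i_def)
  have lim: "lim_ord \<gamma>" and nx_less: "\<And>b. b < \<gamma> \<Longrightarrow> nx b < \<gamma>" and "\<gamma> \<in> D\<^sub>2" using \<gamma>(2) by (auto simp: D_def)
  have "\<gamma> < \<delta>" using \<gamma>(1) C_less[OF Cseq] by (auto simp: nacc_set_def)
  obtain \<epsilon>\<^sub>2 where \<epsilon>\<^sub>2: "\<epsilon>\<^sub>2 < \<gamma>" "\<And>\<xi>. \<epsilon>\<^sub>2 < \<xi> \<Longrightarrow> \<xi> \<le> \<gamma> \<Longrightarrow> rho0 C \<xi> \<delta> = i \<gamma> # rho0 C \<xi> \<gamma>"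
    using rho0_through_nacc[OF Cseq \<gamma>(1)] lim by (auto simp: lim_ord_def i_def)
  define \<epsilon> where "\<epsilon> = max \<epsilon>\<^sub>1 \<epsilon>\<^sub>2"
  have \<epsilon>: "\<epsilon> < \<gamma>" using \<gamma>(4) \<epsilon>\<^sub>2(1) by (simp add: \<epsilon>_def)
  have walk: "snd x \<xi> = snd x \<delta> @ i \<gamma> # rho0 C \<xi> \<gamma>" if "x \<in> X" "\<epsilon> < \<xi>" "\<xi> \<le> \<gamma>" for x \<xi>
    using \<epsilon>\<^sub>1(2)[of x \<xi>] \<epsilon>\<^sub>2(2)[of \<xi>] that \<open>\<gamma> < \<delta>\<close> by (auto simp: \<epsilon>_def)
  have walk\<gamma>: "snd x \<xi> = snd x \<gamma> @ rho0 C \<xi> \<gamma>" if "x \<in> X" "\<epsilon> < \<xi>" "\<xi> \<le> \<gamma>" for x \<xi>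
    using walk[OF that] walk[OF that(1) \<epsilon>] rho0_refl[OF Cseq] by simp
  define \<eta>\<^sub>1 where "\<eta>\<^sub>1 = nx \<epsilon>"
  \<comment> \<open>As a successor \<eta> is not in \<open>V_set C\<close>, so a splitting point
    \<Delta> in E would be strictly above \<eta> and leave an interval of agreement below it. Its
    predecessor \<open>\<eta>\<^sub>1\<close> in E keeps the point of reading above
    \<epsilon>.\<close>
  define \<eta> where "\<eta> = (LEAST z. \<eta>\<^sub>1 < z)"
  have \<eta>\<^sub>1: "\<epsilon> < \<eta>\<^sub>1" "\<eta>\<^sub>1 \<in> E" "\<eta>\<^sub>1 < \<gamma>" using nx nx_less \<epsilon> by (auto simp: \<eta>\<^sub>1_def)
  then obtain z where z: "\<eta>\<^sub>1 < z" "z < \<gamma>" using lim unfolding lim_ord_def by blast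
  have "\<eta>\<^sub>1 < \<eta>" and least: "\<And>z. \<eta>\<^sub>1 < z \<Longrightarrow> \<eta> \<le> z"
    unfolding \<eta>_def using z(1) by (auto intro: LeastI Least_le)
  then have \<eta>: "\<epsilon> < \<eta>\<^sub>1" "\<eta>\<^sub>1 \<in> E" "\<eta>\<^sub>1 < \<eta>" "\<eta> < \<gamma>" using \<eta>\<^sub>1 le_less_trans[OF least[OF z(1)] z(2)] by auto
  have "\<gamma> \<in> E"
  proof (rule club_closed[OF E(1)])
    show "\<forall>b<\<gamma>. \<exists>e\<in>E. b < e \<and> e < \<gamma>" using nx nx_less by blast
  qed (use \<eta> in blast)
  define ss where "ss = map (map (\<lambda>x. restr (snd x) \<eta>)) ys"
  define Ws where "Ws = map (map (\<lambda>x. snd x \<gamma>)) ys"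
  have set_ys: "x \<in> X" if "\<sigma> \<in> set ys" "x \<in> set \<sigma>" for \<sigma> x using that ys by (auto simp: X_def)
  have Z\<gamma>: "\<gamma> \<in> pattern_points S E (\<eta>, ss, Ws)"
    unfolding pattern_points_def
  proof (intro CollectI conjI bexI[of _ ys] ballI allI impI)
    show "ys \<in> lists S" using ys Y(2) by (auto simp: good_def)
    fix \<sigma> x assume "\<sigma> \<in> set ys" "x \<in> set \<sigma>"
    then have "x \<in> X" by (rule set_ys)
    then show "\<gamma> < fst x" using X(3) \<open>\<gamma> < \<delta>\<close> less_trans by blast
    fix \<xi> assume "fst (\<eta>, ss, Ws) \<le> \<xi>" "\<xi> < \<gamma>"
    then show "snd x \<xi> = snd x \<gamma> @ rho0 C \<xi> \<gamma>"
      using walk\<gamma>[OF \<open>x \<in> X\<close>, of \<xi>] \<eta> by simp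
  qed (use \<open>\<gamma> \<in> E\<close> in \<open>auto simp: ss_def Ws_def\<close>)
  have ent: "a < \<gamma>" if x: "x \<in> X" and a: "a \<in> set (snd x \<gamma>)" for x a
  proof -
    have "\<gamma> < fst x" using X(3)[OF x] \<open>\<gamma> < \<delta>\<close> by simp
    then obtain \<alpha> where "\<gamma> < \<alpha>" "snd x \<gamma> = rho0 C \<gamma> \<alpha>"
      using rho0_tree_node[of x C] X(2) x by (meson less_le_trans subsetD)
    then show ?thesis using rho0_less_R[OF Cseq \<gamma>(3)] a by simp
  qed
  \<comment> \<open>A bound strictly below \<gamma> for \<eta> and all recorded entries puts the
    pattern into \<open>patterns_below b\<close>, as reflection at \<gamma> requires.\<close>
  have "\<exists>b<\<gamma>. \<forall>a\<in>insert \<eta> (\<Union>x\<in>X. set (snd x \<gamma>)). a < b"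
  proof (rule finite_uniform_bound)
    fix a assume "a \<in> insert \<eta> (\<Union>x\<in>X. set (snd x \<gamma>))"
    then have "a < \<gamma>" using ent \<eta>(4) by blast
    then show "\<exists>\<epsilon><\<gamma>. a < \<epsilon>" using lim by (auto simp: lim_ord_def)
  qed (use X(1) \<eta>(4) in auto)
  then obtain b where b: "b < \<gamma>" "\<eta> < b" "\<And>x a. x \<in> X \<Longrightarrow> a \<in> set (snd x \<gamma>) \<Longrightarrow> a < b" by auto
  have level: "restr (snd x) \<eta> \<in> {x \<in> rho0_tree C. fst x = \<eta>}" if "x \<in> X" for x
  proof -
    have "\<eta> \<le> fst x" using X(3)[OF that] \<eta>(4) \<open>\<gamma> < \<delta>\<close> by simp
    moreover have "fst (restr (snd x) \<eta>) = \<eta>" by (simp add: restr_def)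
    ultimately show ?thesis using restr_in_rho0_tree[of x C \<eta>] X(2) that by auto
  qed
  have "map (\<lambda>x. restr (snd x) \<eta>) \<sigma> \<in> lists {x \<in> rho0_tree C. fst x = \<eta>}"
    and "map (\<lambda>x. snd x \<gamma>) \<sigma> \<in> lists (lists {x. x < b})" if "\<sigma> \<in> set ys" for \<sigma>
    unfolding in_lists_conv_set set_map using level b(3) set_ys[OF that] by blast+
  then have "ss \<in> lists (lists {x \<in> rho0_tree C. fst x = \<eta>})" "Ws \<in> lists (lists (lists {x. x < b}))"
    by (auto simp: ss_def Ws_def in_lists_conv_set[of _ "lists _"] simp del: in_listsI)
  then have "(\<eta>, ss, Ws) \<in> patterns_below b" using b(2) by (simp add: patterns_below_def)
  then obtain \<gamma>' where \<gamma>': "\<gamma>' \<in> pattern_points S E (\<eta>, ss, Ws)" "\<gamma> < \<gamma>'"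
    using reflect[OF \<open>\<gamma> \<in> D\<^sub>2\<close> b(1) _ Z\<gamma>] by blast
  then obtain ys' where ys': "ys' \<in> lists S" "map (map (\<lambda>x. restr (snd x) \<eta>)) ys' = ss"
    "map (map (\<lambda>x. snd x \<gamma>')) ys' = Ws" and
    ys'': "\<And>\<sigma> x. \<sigma> \<in> set ys' \<Longrightarrow> x \<in> set \<sigma> \<Longrightarrow> \<gamma>' < fst x"
    "\<And>\<sigma> x \<xi>. \<sigma> \<in> set ys' \<Longrightarrow> x \<in> set \<sigma> \<Longrightarrow> \<eta> \<le> \<xi> \<Longrightarrow> \<xi> < \<gamma>' \<Longrightarrow> snd x \<xi> = snd x \<gamma>' @ rho0 C \<xi> \<gamma>'"
    unfolding pattern_points_def fst_conv snd_conv by blast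

  have V: "\<gamma> \<in> V_set C" using \<open>\<gamma> \<in> E\<close> E(2) by blast
  \<comment> \<open>Agreement on all of [\<eta>, \<gamma>) would make \<open>C \<gamma>\<close> and
    \<open>C \<gamma>'\<close> coincide on a tail below \<gamma>. The least difference \<Delta>
    involves only \<eta>, \<gamma> and \<gamma>', hence is common to all tuples and
    coordinates.\<close>
  have "\<exists>\<xi>. \<eta> \<le> \<xi> \<and> \<xi> < \<gamma> \<and> rho0 C \<xi> \<gamma> \<noteq> rho0 C \<xi> \<gamma>'"
    using rho0_agree_imp_C_agree[OF Cseq, of \<eta> \<gamma> \<gamma> \<gamma>'] V \<gamma>'(2) lim \<eta>(4) by (force simp: V_set_def)
  define \<Delta> where "\<Delta> = (LEAST \<xi>. \<eta> \<le> \<xi> \<and> \<xi> < \<gamma> \<and> rho0 C \<xi> \<gamma> \<noteq> rho0 C \<xi> \<gamma>')"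
  have \<Delta>: "\<eta> \<le> \<Delta>" "\<Delta> < \<gamma>" "rho0 C \<Delta> \<gamma> \<noteq> rho0 C \<Delta> \<gamma>'"
    using LeastI_ex[OF \<open>\<exists>\<xi>. \<eta> \<le> \<xi> \<and> _\<close>] by (auto simp: \<Delta>_def)
  have below: "rho0 C \<xi> \<gamma> = rho0 C \<xi> \<gamma>'" if "\<eta> \<le> \<xi>" "\<xi> < \<Delta>" for \<xi>
    using not_less_Least[OF that(2)[unfolded \<Delta>_def]] that \<Delta>(2) by auto
  \<comment> \<open>For \<Delta> in E the agreement below \<Delta> would extend to \<Delta> by
    \<open>rho0_agree_at_V\<close>. Being outside E guarantees a last point of E below \<Delta>, at
    which the meet is read.\<close>
  have "\<Delta> \<notin> E"
  proof
    assume "\<Delta> \<in> E"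
    then have "\<Delta> \<in> V_set C" using E(2) by blast
    show False
    proof (cases "\<eta> = \<Delta>")
      case True
      then have "\<eta>\<^sub>1 < \<Delta>" using \<eta>(3) by simp
      then obtain z where "\<eta>\<^sub>1 < z" "z < \<Delta>"
        using \<open>\<Delta> \<in> V_set C\<close> by (auto simp: V_set_def lim_ord_def)
      then show False using least[of z] True by simp
    next
      case False
      then have "\<eta> < \<Delta>" "\<Delta> \<le> \<gamma>" "\<Delta> \<le> \<gamma>'" using \<Delta>(1,2) \<gamma>'(2) by simp_all
      then show False using rho0_agree_at_V[OF Cseq \<open>\<Delta> \<in> V_set C\<close> _ _ _ below] \<Delta>(3) by blast
    qed
  qed
  define e where "e = last_below E \<Delta>"
  have e: "e < \<Delta>" "\<eta>\<^sub>1 \<le> e"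
    using last_below[OF E(1) \<eta>(2) _ \<open>\<Delta> \<notin> E\<close>] \<eta> \<Delta>(1) by (auto simp: e_def)

  define w\<^sub>2 where "w\<^sub>2 = map L (rho0 C e \<gamma>)"
  \<comment> \<open>Only now is the rest of the walk at the point of reading known; it singles out
    \<sigma>, and \<sigma>' will be its counterpart at \<gamma>'.\<close>
  have "sel n N (map fst w\<^sub>2) \<in> ?word ` Y" unfolding Y(3) by (rule Q(3))
  then obtain \<sigma> where \<sigma>: "\<sigma> \<in> Y" "sel n N (map fst w\<^sub>2) = ?word \<sigma>" by blast
  then have "\<sigma> \<in> set ys" by (simp add: ys)
  then obtain j where j: "j < length ys" "ys ! j = \<sigma>" unfolding in_set_conv_nth by blast
  have len': "length ys' = length ys" using arg_cong[OF ys'(2), of length] by (simp add: ss_def)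
  define \<sigma>' where "\<sigma>' = ys' ! j"
  have \<sigma>S: "\<sigma> \<in> S" "\<sigma>' \<in> S" "\<sigma>' \<in> set ys'" "\<sigma> \<in> set ys" and good: "good \<sigma>"
    using \<sigma>(1) Y(2) ys' j len' by (auto simp: good_def \<sigma>'_def)
  have r: "map (\<lambda>x. restr (snd x) \<eta>) \<sigma>' = map (\<lambda>x. restr (snd x) \<eta>) \<sigma>"
    "map (\<lambda>x. snd x \<gamma>') \<sigma>' = map (\<lambda>x. snd x \<gamma>) \<sigma>"
    using arg_cong[OF ys'(2), of "\<lambda>z. z ! j"] arg_cong[OF ys'(3), of "\<lambda>z. z ! j"] j len'
    by (auto simp: ss_def Ws_def \<sigma>'_def)
  have key: "Delta (\<sigma> ! k) (\<sigma>' ! k) = \<Delta> \<and> (\<forall>\<xi><\<Delta>. snd (\<sigma> ! k) \<xi> = snd (\<sigma>' ! k) \<xi>) \<and>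
      \<Delta> < fst (\<sigma> ! k) \<and> \<Delta> < fst (\<sigma>' ! k) \<and> snd (\<sigma> ! k) \<Delta> \<noteq> snd (\<sigma>' ! k) \<Delta> \<and>
      node_colour n E L (restr (snd (\<sigma> ! k)) \<Delta>) = cs ! k" if k: "k < n" for k
  proof -
    let ?y = "\<sigma> ! k" and ?x = "\<sigma>' ! k"
    have kl: "k < length \<sigma>" "k < length \<sigma>'" using S_n \<sigma>S k by auto
    have y: "?y \<in> X" and x: "?x \<in> set \<sigma>'" using kl set_ys[OF \<open>\<sigma> \<in> set ys\<close>] by auto
    have r\<eta>: "restr (snd ?x) \<eta> = restr (snd ?y) \<eta>" and r\<gamma>: "snd ?x \<gamma>' = snd ?y \<gamma>"
      using arg_cong[OF r(1), of "\<lambda>z. z ! k"] arg_cong[OF r(2), of "\<lambda>z. z ! k"] kl by auto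
    \<comment> \<open>Below \<eta> the recorded restrictions coincide; from \<eta> on, a common word
      is followed by the walk from \<gamma> or from \<gamma>'.\<close>
    have agree: "snd ?y \<xi> = snd ?x \<xi>" if "\<xi> < \<Delta>" for \<xi>
    proof (cases "\<xi> < \<eta>")
      case True
      then show ?thesis using fun_cong[OF arg_cong[OF r\<eta>, of snd], of \<xi>] by (simp add: restr_def)
    next
      case False
      then show ?thesis
        using walk\<gamma>[OF y, of \<xi>] ys''(2)[OF \<sigma>S(3) x, of \<xi>] r\<gamma> below[of \<xi>] that \<Delta>(2) \<eta> \<gamma>'(2) by simp
    qed
    have differ: "snd ?y \<Delta> \<noteq> snd ?x \<Delta>"
      using walk\<gamma>[OF y, of \<Delta>] ys''(2)[OF \<sigma>S(3) x, of \<Delta>] r\<gamma> \<Delta> \<eta> \<gamma>'(2) by simp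
    have hts: "\<Delta> < fst ?y" "\<Delta> < fst ?x"
      using X(3)[OF y] ys''(1)[OF \<sigma>S(3) x] \<Delta>(2) \<open>\<gamma> < \<delta>\<close> \<gamma>'(2) by auto
    have "snd (restr (snd ?y) \<Delta>) (last_below E (fst (restr (snd ?y) \<Delta>))) = snd ?y e"
      using e(1) by (simp add: restr_def e_def)
    also have "\<dots> = snd ?y \<delta> @ i \<gamma> # rho0 C e \<gamma>" using walk[OF y] e \<eta> \<Delta>(2) by simp
    finally have "node_colour n E L (restr (snd ?y) \<Delta>) =
        word_colour n (map L (snd ?y \<delta>) @ (N, cs) # w\<^sub>2)"
      by (simp add: node_colour_def w\<^sub>2_def \<gamma>(5))
    also have "\<dots> = cs ! k"
    proof (rule word_colour_eq[OF \<sigma>(2)])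
      \<comment> \<open>Equal words come from walks of equal length, for which admissibility demands
        equal colours.\<close>
      fix k' assume k': "k' < length (?word \<sigma>)" and eq: "?word \<sigma> ! k' = ?word \<sigma> ! k"
      then have "length (snd (\<sigma> ! k') \<delta>) = length (snd ?y \<delta>)"
        using kl by (auto dest: map_eq_imp_length_eq)
      moreover have "admissible cs \<delta> \<sigma>" using good by (simp add: good_def)
      moreover have "k' < length cs" "k < length cs" using k k' S_n[OF \<sigma>S(1)] cs by auto
      ultimately show "cs ! k' = cs ! k" unfolding admissible_def by blast
    qed (use kl in auto)
    finally show ?thesis using agree differ hts Delta_eq[of \<Delta> ?y ?x] by auto
  qed
  \<comment> \<open>With the lower tuple first, the lexicographic clause holds through its
    conclusion; rapidity provides this order of \<sigma> and \<sigma>'.\<close>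
  have pair: "good_pair (node_colour n E L) n 1 ((!) cs) xs ys"
    if "{xs, ys} = {\<sigma>, \<sigma>'}" and less: "\<forall>x\<in>set xs. \<forall>y\<in>set ys. fst x < fst y" for xs ys
  proof -
    have mt: "meet (xs ! k) (ys ! k) = restr (snd (\<sigma> ! k)) \<Delta>" if k: "k < n" for k
    proof -
      note K = key[OF k]
      have D': "Delta (\<sigma>' ! k) (\<sigma> ! k) = \<Delta>" using K by (intro Delta_eq) auto
      have "restr (snd (\<sigma>' ! k)) \<Delta> = restr (snd (\<sigma> ! k)) \<Delta>" using K by (auto simp: restr_def fun_eq_iff)
      then show ?thesis using \<open>{xs, ys} = {\<sigma>, \<sigma>'}\<close> K D' by (auto simp: meet_def doubleton_eq_iff)
    qed
    have "(\<lambda>k. fst (meet (xs ! k) (ys ! k))) ` {..<n} \<subseteq> {\<Delta>}" by (auto simp: mt restr_def)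
    then have "card ((\<lambda>k. fst (meet (xs ! k) (ys ! k))) ` {..<n}) \<le> 1"
      using card_mono[of "{\<Delta>}"] by fastforce
    moreover have l: "length xs = n" "length ys = n"
      using \<open>{xs, ys} = {\<sigma>, \<sigma>'}\<close> S_n \<sigma>S by (auto simp: doubleton_eq_iff)
    moreover have "xs \<noteq> ys" using less l n by (metis less_irrefl nth_mem)
    ultimately show ?thesis using key mt less by (auto simp: good_pair_def)
  qed
  have "\<sigma> \<noteq> \<sigma>'" using key[OF n] by auto
  then consider "\<forall>x\<in>set \<sigma>. \<forall>y\<in>set \<sigma>'. fst x < fst y" | "\<forall>x\<in>set \<sigma>'. \<forall>y\<in>set \<sigma>. fst x < fst y"
    using S(2) \<sigma>S unfolding rapid_def by blast
  then show ?thesis using pair[of \<sigma> \<sigma>'] pair[of \<sigma>' \<sigma>] \<sigma>S by cases blast+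
qed

end

lemma surj_onto_tuples:
  assumes "infinite (UNIV :: 'm set)"
  shows "\<exists>s :: 'm \<Rightarrow> 'm list. \<forall>cs. length cs = n \<longrightarrow> cs \<in> range s"
proof -
  obtain g where "bij_betw g (UNIV \<times> UNIV :: ('m \<times> 'm) set) (UNIV :: 'm set)"
    using iffD2[OF card_of_ordIso card_of_Times_same_infinite[OF assms]] by blast
  from bij_betw_inv_into[OF this] obtain f :: "'m \<Rightarrow> 'm \<times> 'm" where "surj f"
    unfolding UNIV_Times_UNIV using bij_betw_imp_surj_on by blast
  then have f: "\<exists>x. f x = (a, b)" for a b by (metis surjD)
  show ?thesis
  proof (induction n)
    case 0
    show ?case by (intro exI[of _ "\<lambda>_. []"]) auto
  next
    case (Suc n)
    then obtain s :: "'m \<Rightarrow> 'm list" where s: "\<And>cs. length cs = n \<Longrightarrow> cs \<in> range s" by blast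
    have "cs \<in> range (\<lambda>x. fst (f x) # s (snd (f x)))" if cs: "length cs = Suc n" for cs
    proof -
      obtain a ds where "cs = a # ds" "length ds = n" using cs by (auto simp: length_Suc_conv)
      moreover from this obtain y where "ds = s y" using s by blast
      moreover obtain x where "f x = (a, y)" using f by blast
      ultimately show ?thesis by (intro image_eqI[of _ _ x]) auto
    qed
    then show ?case by blast
  qed
qed

text \<open>With finitely many colours there are countably many pairs of a letter and a list, so h
  alone codes them. With infinitely many, \<open>surj_onto_tuples\<close> expands the value of g to
  n colours and h gives the letter. Either way one \<nu> serves all N.\<close>

lemma Theta1_imp_guess:
  assumes \<Theta>: "Theta1 (A_set C) C (R_set C) (UNIV :: 'm set) (UNIV :: nat set)"
  shows "\<exists>L :: 'a::wellorder \<Rightarrow> nat \<times> 'm list. guess C n L"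
proof -
  obtain g :: "'a \<Rightarrow> 'm" and h :: "'a \<Rightarrow> nat" where gh:
    "\<forall>D. club D \<longrightarrow> (\<forall>\<nu>\<in>UNIV. \<exists>\<delta>\<in>A_set C. \<forall>\<tau>\<in>UNIV. sup_is {\<gamma> \<in> nacc_set (C \<delta>) \<inter> D \<inter> R_set C.
        g (otp (C \<delta> \<inter> {x. x < \<gamma>})) = \<nu> \<and> h (otp (C \<delta> \<inter> {x. x < \<gamma>})) = \<tau>} \<delta>)"
    using \<Theta> unfolding Theta1_def by blast
  have "\<exists>L :: 'a \<Rightarrow> nat \<times> 'm list. \<forall>cs. length cs = n \<longrightarrow> (\<exists>\<nu>. \<forall>N. \<exists>\<tau>. \<forall>i. g i = \<nu> \<longrightarrow> h i = \<tau> \<longrightarrow> L i = (N, cs))"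
  proof (cases "finite (UNIV :: 'm set)")
    case True
    then have c: "countable (UNIV :: (nat \<times> 'm list) set)"
      using countable_lists[OF countable_finite[OF True]]
      by (simp add: UNIV_Times_UNIV[symmetric] del: UNIV_Times_UNIV)
    define d :: "nat \<Rightarrow> nat \<times> 'm list" where "d = from_nat_into UNIV"
    have "surj d" unfolding d_def using range_from_nat_into[OF _ c] by simp
    then have "\<exists>\<tau>. d \<tau> = x" for x by (metis surjD)
    then show ?thesis by (intro exI[of _ "\<lambda>i. d (h i)"]) metis
  next
    case False
    then obtain s :: "'m \<Rightarrow> 'm list" where s: "\<And>cs. length cs = n \<Longrightarrow> cs \<in> range s"
      using surj_onto_tuples[OF False, of n] by blast
    then have "\<exists>\<nu>. s \<nu> = cs" if "length cs = n" for cs using s[OF that] by blast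
    then show ?thesis by (intro exI[of _ "\<lambda>i. (h i, s (g i))"]) metis
  qed
  then obtain L :: "'a \<Rightarrow> nat \<times> 'm list" where
    L: "\<And>cs. length cs = n \<Longrightarrow> \<exists>\<nu>. \<forall>N. \<exists>\<tau>. \<forall>i. g i = \<nu> \<longrightarrow> h i = \<tau> \<longrightarrow> L i = (N, cs)" by blast
  have "guess C n L" unfolding guess_def
  proof (intro allI impI)
    fix D :: "'a set" and cs :: "'m list" assume D: "club D" and cs: "length cs = n"
    obtain \<nu> where \<nu>: "\<And>N. \<exists>\<tau>. \<forall>i. g i = \<nu> \<longrightarrow> h i = \<tau> \<longrightarrow> L i = (N, cs)" using L[OF cs] by blast
    obtain \<delta> where \<delta>: "\<delta> \<in> A_set C" and sup: "\<And>\<tau>. sup_is {\<gamma> \<in> nacc_set (C \<delta>) \<inter> D \<inter> R_set C.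
        g (otp (C \<delta> \<inter> {x. x < \<gamma>})) = \<nu> \<and> h (otp (C \<delta> \<inter> {x. x < \<gamma>})) = \<tau>} \<delta>"
      using gh D by blast
    show "\<exists>\<delta>\<in>A_set C. \<forall>N. \<forall>\<beta><\<delta>. \<exists>\<gamma>\<in>nacc_set (C \<delta>) \<inter> D \<inter> R_set C.
       \<beta> < \<gamma> \<and> L (otp (C \<delta> \<inter> {x. x < \<gamma>})) = (N, cs)"
    proof (intro bexI[OF _ \<delta>] allI impI)
      fix N \<beta> assume "\<beta> < \<delta>"
      obtain \<tau> where \<tau>: "\<And>i. g i = \<nu> \<Longrightarrow> h i = \<tau> \<Longrightarrow> L i = (N, cs)" using \<nu> by blast
      show "\<exists>\<gamma>\<in>nacc_set (C \<delta>) \<inter> D \<inter> R_set C. \<beta> < \<gamma> \<and> L (otp (C \<delta> \<inter> {x. x < \<gamma>})) = (N, cs)"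
        using sup[of \<tau>] \<open>\<beta> < \<delta>\<close> \<tau> unfolding sup_is_def by blast
    qed
  qed
  then show ?thesis by blast
qed

section \<open>Families of tuples for the two clauses\<close>

context guessing_walks
begin

text \<open>Rapidity makes the first heights distinct, hence unbounded. A second tuple whose first
  height exceeds one above \<zeta> lies above that height entirely.\<close>

lemma rapid_unbounded:
  fixes T :: "'a node set"
  assumes "S \<subseteq> ntuples T n" "0 < n" "rapid S" "S \<approx> (UNIV :: 'a set)"
  shows "\<exists>\<sigma>\<in>S. \<forall>x\<in>set \<sigma>. \<zeta> < fst x"
proof -
  have hd: "\<sigma> ! 0 \<in> set \<sigma>" if "\<sigma> \<in> S" for \<sigma> using assms(1,2) that by (force simp: ntuples_def)
  let ?f = "\<lambda>\<sigma>. fst (\<sigma> ! 0)"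
  have "inj_on ?f S"
  proof (rule inj_onI, rule ccontr)
    fix \<sigma> \<sigma>' assume "\<sigma> \<in> S" "\<sigma>' \<in> S" "?f \<sigma> = ?f \<sigma>'" "\<sigma> \<noteq> \<sigma>'"
    then show False using assms(3) hd unfolding rapid_def by (metis less_irrefl)
  qed
  note unb = unbounded_eqpoll_imp[OF assms(4) this]
  obtain \<sigma>\<^sub>1 where \<sigma>\<^sub>1: "\<sigma>\<^sub>1 \<in> S" "\<zeta> < ?f \<sigma>\<^sub>1" using unb by blast
  obtain \<sigma>\<^sub>2 where \<sigma>\<^sub>2: "\<sigma>\<^sub>2 \<in> S" "?f \<sigma>\<^sub>1 < ?f \<sigma>\<^sub>2" using unb by blast
  have "\<sigma>\<^sub>1 \<noteq> \<sigma>\<^sub>2" using \<sigma>\<^sub>2 by auto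
  then have "(\<forall>x\<in>set \<sigma>\<^sub>1. \<forall>y\<in>set \<sigma>\<^sub>2. fst x < fst y) \<or> (\<forall>x\<in>set \<sigma>\<^sub>1. \<forall>y\<in>set \<sigma>\<^sub>2. fst y < fst x)"
    using assms(3) \<sigma>\<^sub>1(1) \<sigma>\<^sub>2(1) unfolding rapid_def by blast
  then have "\<forall>y\<in>set \<sigma>\<^sub>2. ?f \<sigma>\<^sub>1 < fst y" using hd \<sigma>\<^sub>1(1) \<sigma>\<^sub>2 by (metis less_asym)
  then show ?thesis using \<sigma>\<^sub>1(2) \<sigma>\<^sub>2(1) less_trans by blast
qed

text \<open>Levels are small, so a set of size kappa does not fit into boundedly many of
  them.\<close>

lemma unbounded_heights:
  assumes "T' \<subseteq> rho0_tree C" "T' \<approx> (UNIV :: 'a set)"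
  shows "\<exists>x\<in>T'. \<zeta> < fst x"
proof (rule ccontr)
  assume "\<not> ?thesis"
  then have "T' \<subseteq> (\<Union>\<eta>\<in>{\<eta>. \<eta> \<le> \<zeta>}. {x \<in> rho0_tree C. fst x = \<eta>})" using assms(1) by (auto simp: not_less)
  moreover have "sm \<dots>" by (intro small_UN sm_atMost sm_level)
  ultimately have "sm T'" using small_subset by blast
  then show False using eqpoll_not_sm[OF assms(2)] by simp
qed

text \<open>Over each d of a stationary set, n nodes with pairwise different walk lengths to d are
  chosen. After pressing down, their walks to any \<delta> between \<epsilon> and d run through d
  and lengthen by the same amount, so the lengths stay different.\<close>

lemma separated_family:
  assumes T': "T' \<subseteq> rho0_tree C" "T' \<approx> (UNIV :: 'a set)" and n: "0 < n"
  shows "\<exists>S' \<epsilon>. S' \<subseteq> ntuples T' n \<and> rapid S' \<and> S' \<approx> (UNIV :: 'a set) \<and>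
    (\<forall>S\<subseteq>S'. S \<approx> (UNIV :: 'a set) \<longrightarrow> (\<forall>\<zeta>. \<exists>\<sigma>\<in>S. (\<forall>x\<in>set \<sigma>. \<zeta> < fst x) \<and>
       (\<forall>\<delta>. \<epsilon> < \<delta> \<longrightarrow> \<delta> < \<zeta> \<longrightarrow> inj_on (\<lambda>k. length (snd (\<sigma> ! k) \<delta>)) {..<n})))"
proof -
  have "\<exists>D. club D \<and> (\<forall>\<delta>\<in>D \<inter> A_set C. \<forall>m. \<exists>\<sigma>\<in>(\<lambda>x. [x]) ` T'. (\<forall>x\<in>set \<sigma>. \<delta> < fst x) \<and> True \<and>
      (\<forall>x\<in>set \<sigma>. m \<le> length (snd x \<delta>)))"
    using unbounded_heights[OF T'] T'(1) by (intro long_tuples[where \<epsilon>\<^sub>0 = undefined and adm = "\<lambda>_ _. True"]) auto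
  then obtain D where D: "club D" and
    long: "\<And>\<delta> m. \<delta> \<in> D \<Longrightarrow> \<delta> \<in> A_set C \<Longrightarrow> \<exists>x\<in>T'. \<delta> < fst x \<and> m \<le> length (snd x \<delta>)"
    by auto
  have ex: "\<exists>\<sigma>. length \<sigma> = m \<and> set \<sigma> \<subseteq> {x \<in> T'. d < fst x} \<and>
      inj_on (\<lambda>k. length (snd (\<sigma> ! k) d)) {..<m}" if d: "d \<in> D" "d \<in> A_set C" for d m
  proof (induction m)
    case (Suc m)
    then obtain \<sigma> where \<sigma>: "length \<sigma> = m" "set \<sigma> \<subseteq> {x \<in> T'. d < fst x}"
      "inj_on (\<lambda>k. length (snd (\<sigma> ! k) d)) {..<m}" by blast
    define l where "l = Suc (\<Sum>x\<leftarrow>\<sigma>. length (snd x d))"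
    obtain x where x: "x \<in> T'" "d < fst x" "l \<le> length (snd x d)" using long[OF d] by blast
    have "length (snd (\<sigma> ! k) d) < length (snd x d)" if "k < m" for k
    proof -
      have "length (snd (\<sigma> ! k) d) \<le> (\<Sum>x\<leftarrow>\<sigma>. length (snd x d))"
        using that \<sigma>(1) by (intro member_le_sum_list) auto
      then show ?thesis using x(3) by (simp add: l_def)
    qed
    then have "inj_on (\<lambda>k. length (snd ((\<sigma> @ [x]) ! k) d)) {..<Suc m}"
      using \<sigma>(1,3) by (auto simp: inj_on_def nth_append less_Suc_eq) (metis less_irrefl)+
    then show ?case using \<sigma> x by (intro exI[of _ "\<sigma> @ [x]"]) auto
  qed simp
  define B where "B = A_set C \<inter> D"
  have B: "stationary B" unfolding B_def by (rule stationary_Int_club[OF A_stationary D])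
  have "\<forall>d\<in>B. \<exists>\<sigma>. length \<sigma> = n \<and> set \<sigma> \<subseteq> {x \<in> T'. d < fst x} \<and>
      inj_on (\<lambda>k. length (snd (\<sigma> ! k) d)) {..<n}" using ex by (auto simp: B_def)
  from bchoice[OF this] obtain \<sigma> where \<sigma>: "\<And>d. d \<in> B \<Longrightarrow> length (\<sigma> d) = n"
    "\<And>d. d \<in> B \<Longrightarrow> set (\<sigma> d) \<subseteq> T'" "\<And>d x. d \<in> B \<Longrightarrow> x \<in> set (\<sigma> d) \<Longrightarrow> d < fst x"
    "\<And>d. d \<in> B \<Longrightarrow> inj_on (\<lambda>k. length (snd (\<sigma> d ! k) d)) {..<n}" by blast
  have "\<exists>\<epsilon><d. \<forall>x\<in>set (\<sigma> d). \<forall>\<xi>. \<epsilon> < \<xi> \<longrightarrow> \<xi> < d \<longrightarrow> snd x \<xi> = snd x d @ rho0 C \<xi> d" if d: "d \<in> B" for d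
    using nodes_through_A[of d "set (\<sigma> d)"] \<sigma>(2,3)[OF d] T'(1) d by (auto simp: B_def)
  then have "\<forall>d\<in>B. \<exists>\<epsilon>. \<epsilon> < d \<and> (\<forall>x\<in>set (\<sigma> d). \<forall>\<xi>. \<epsilon> < \<xi> \<longrightarrow> \<xi> < d \<longrightarrow> snd x \<xi> = snd x d @ rho0 C \<xi> d)"
    by blast
  from bchoice[OF this] obtain f where f: "\<And>d. d \<in> B \<Longrightarrow> f d < d" and
    f': "\<And>d x \<xi>. d \<in> B \<Longrightarrow> x \<in> set (\<sigma> d) \<Longrightarrow> f d < \<xi> \<Longrightarrow> \<xi> < d \<Longrightarrow> snd x \<xi> = snd x d @ rho0 C \<xi> d"
    by blast
  obtain \<epsilon> where \<epsilon>: "stationary {d \<in> B. f d \<le> \<epsilon>}" using pressing_down[OF B f] by blast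
  \<comment> \<open>H bounds the heights of the tuple at d; restricting to indices closed under H
    makes the family rapid.\<close>
  have "\<forall>d. \<exists>b. \<forall>x\<in>set (\<sigma> d). fst x < b" using smallD[OF sm_finite, of "set _" fst] by blast
  from choice[OF this] obtain H where H: "\<And>d x. x \<in> set (\<sigma> d) \<Longrightarrow> fst x < H d" by blast
  define \<Gamma> where "\<Gamma> = {d \<in> B. f d \<le> \<epsilon>} \<inter> {\<gamma>. lim_ord \<gamma> \<and> (\<forall>b<\<gamma>. H b < \<gamma>)}"
  have \<Gamma>: "stationary \<Gamma>" unfolding \<Gamma>_def by (intro stationary_Int_club \<epsilon> club_closure_points)
  have \<Gamma>B: "d \<in> B" "f d \<le> \<epsilon>" if "d \<in> \<Gamma>" for d using that by (auto simp: \<Gamma>_def)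
  have below: "fst x < fst y" if "d \<in> \<Gamma>" "d' \<in> \<Gamma>" "d < d'" "x \<in> set (\<sigma> d)" "y \<in> set (\<sigma> d')" for d d' x y
  proof -
    have "fst x < H d" by (rule H[OF that(4)])
    also have "\<dots> < d'" using that by (auto simp: \<Gamma>_def)
    also have "\<dots> < fst y" using \<sigma>(3) \<Gamma>B that by blast
    finally show ?thesis .
  qed
  have hd: "\<sigma> d ! 0 \<in> set (\<sigma> d)" if "d \<in> \<Gamma>" for d using \<sigma>(1)[OF \<Gamma>B(1)[OF that]] n by simp
  have inj: "inj_on \<sigma> \<Gamma>"
  proof (rule linorder_inj_onI')
    fix d d' assume "d \<in> \<Gamma>" "d' \<in> \<Gamma>" "d < d'"
    then show "\<sigma> d \<noteq> \<sigma> d'" using below[of d d' "\<sigma> d ! 0" "\<sigma> d' ! 0"] hd by auto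
  qed
  have "\<Gamma> \<approx> (UNIV :: 'a set)"
    using stationary_unbounded[OF \<Gamma>] by (intro regular) (meson less_imp_le)
  then have eq: "\<sigma> ` \<Gamma> \<approx> (UNIV :: 'a set)" using inj_on_image_eqpoll_self[OF inj] eqpoll_trans by blast
  have sub: "\<sigma> ` \<Gamma> \<subseteq> ntuples T' n" using \<sigma>(1,2) \<Gamma>B by (auto simp: ntuples_def)
  have rap: "rapid (\<sigma> ` \<Gamma>)" unfolding rapid_def
  proof (intro ballI impI)
    fix s s' assume "s \<in> \<sigma> ` \<Gamma>" "s' \<in> \<sigma> ` \<Gamma>" "s \<noteq> s'"
    then obtain d d' where d: "d \<in> \<Gamma>" "s = \<sigma> d" "d' \<in> \<Gamma>" "s' = \<sigma> d'" "d \<noteq> d'" by blast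
    show "(\<forall>x\<in>set s. \<forall>y\<in>set s'. fst x < fst y) \<or> (\<forall>x\<in>set s. \<forall>y\<in>set s'. fst y < fst x)"
      using below[OF d(1,3)] below[OF d(3,1)] d(2,4,5) by (metis linorder_neqE)
  qed
  have sep: "\<exists>s\<in>S. (\<forall>x\<in>set s. \<zeta> < fst x) \<and>
       (\<forall>\<delta>. \<epsilon> < \<delta> \<longrightarrow> \<delta> < \<zeta> \<longrightarrow> inj_on (\<lambda>k. length (snd (s ! k) \<delta>)) {..<n})"
    if S: "S \<subseteq> \<sigma> ` \<Gamma>" "S \<approx> (UNIV :: 'a set)" for S \<zeta>
  proof -
    have "inj_on (inv_into \<Gamma> \<sigma>) S" using S(1) by (rule inj_on_inv_into)
    from unbounded_eqpoll_imp[OF S(2) this] obtain s where s: "s \<in> S" "\<zeta> < inv_into \<Gamma> \<sigma> s" by blast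
    define d where "d = inv_into \<Gamma> \<sigma> s"
    have d: "d \<in> \<Gamma>" "\<sigma> d = s" "\<zeta> < d" using s S(1) by (auto simp: d_def inv_into_into f_inv_into_f subsetD)
    have "inj_on (\<lambda>k. length (snd (s ! k) \<delta>)) {..<n}" if \<delta>: "\<epsilon> < \<delta>" "\<delta> < \<zeta>" for \<delta>
    proof -
      have "length (snd (s ! k) \<delta>) = length (snd (s ! k) d) + length (rho0 C \<delta> d)" if "k < n" for k
      proof -
        have "s ! k \<in> set (\<sigma> d)" using that \<sigma>(1)[OF \<Gamma>B(1)[OF d(1)]] d(2) by auto
        then have "snd (s ! k) \<delta> = snd (s ! k) d @ rho0 C \<delta> d"
          using \<Gamma>B[OF d(1)] \<delta> d(3) by (intro f') auto
        then show ?thesis by simp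
      qed
      then show ?thesis using \<sigma>(4)[OF \<Gamma>B(1)[OF d(1)]] d(2) by (simp add: inj_on_def)
    qed
    moreover have "\<zeta> < fst x" if "x \<in> set s" for x
      using \<sigma>(3)[OF \<Gamma>B(1)[OF d(1)], of x] d that by auto
    ultimately show ?thesis using s(1) by blast
  qed
  show ?thesis
    by (intro exI[of _ "\<sigma> ` \<Gamma>"] exI[of _ \<epsilon>] conjI allI impI sub rap eq sep)
qed

end

section \<open>The partition relation for the tree of walks\<close>

theorem theorem9p2:
  fixes C :: "'a::wellorder \<Rightarrow> 'a set" and n :: nat
  assumes kappa_uncountable: "\<not> countable (UNIV :: 'a set)"
    and kappa_cardinal: "\<forall>a::'a. {x. x < a} \<prec> (UNIV :: 'a set)"
    and kappa_regular: "\<forall>X::'a set. (\<forall>x. \<exists>y\<in>X. x \<le> y) \<longrightarrow> X \<approx> (UNIV :: 'a set)"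
    and Cseq: "C_sequence C"
    and wc: "weakly_coherent C"
    and V_club: "\<exists>D. club D \<and> D \<subseteq> V_set C"
    and Theta: "Theta1 (A_set C) C (R_set C) (UNIV :: 'm set) (UNIV :: nat set)"
    and n_pos: "0 < n"
  shows "tree_negpart (rho0_tree C) n 1 (UNIV :: 'm set)"
proof -
  obtain L :: "'a \<Rightarrow> nat \<times> 'm list" where L: "guess C n L" using Theta1_imp_guess[OF Theta] by blast
  obtain E where E: "club E" "E \<subseteq> V_set C" using V_club by blast
  have regular: "X \<approx> (UNIV :: 'a set)" if "\<And>x. \<exists>y\<in>X. x \<le> y" for X :: "'a set"
    using kappa_regular[rule_format, of X] that by blast
  interpret guessing_walks "TYPE('a)" C
    by unfold_locales
      (rule kappa_uncountable kappa_cardinal[rule_format] regular Cseq wc guess_imp_stationary[OF Cseq L];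
        assumption?)+
  let ?c = "node_colour n E L"
  note realise = tuples_realise_colours[OF E L n_pos]
  have cong: "good_pair ?c n 1 \<tau> xs ys" if "good_pair ?c n 1 ((!) cs) xs ys" "\<And>k. k < n \<Longrightarrow> cs ! k = \<tau> k"
    for cs \<tau> xs ys using that by (auto simp: good_pair_def)
  have 1: "\<exists>xs\<in>S. \<exists>ys\<in>S. good_pair ?c n 1 (\<lambda>_. \<tau>) xs ys"
    if S: "S \<subseteq> ntuples (rho0_tree C) n" "rapid S" "S \<approx> (UNIV :: 'a set)" for S \<tau>
  proof -
    \<comment> \<open>A constant list is admissible for every tuple at every point, so any value of
      \<open>\<epsilon>\<^sub>0\<close> does.\<close>
    have "\<exists>xs\<in>S. \<exists>ys\<in>S. good_pair ?c n 1 ((!) (replicate n \<tau>)) xs ys"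
      using rapid_unbounded[OF S(1) n_pos S(2,3)]
      by (intro realise[OF S(1,2), where \<epsilon>\<^sub>0 = undefined]) (auto simp: admissible_def)
    then show ?thesis using cong[of "replicate n \<tau>" _ _ "\<lambda>_. \<tau>"] by auto
  qed
  have 2: "\<exists>S'. S' \<subseteq> ntuples T' n \<and> rapid S' \<and> S' \<approx> (UNIV::'a set) \<and>
      (\<forall>S. S \<subseteq> S' \<and> S \<approx> (UNIV::'a set) \<longrightarrow> (\<forall>\<tau>. \<exists>xs\<in>S. \<exists>ys\<in>S. good_pair ?c n 1 \<tau> xs ys))"
    if T': "T' \<subseteq> rho0_tree C" "T' \<approx> (UNIV :: 'a set)" for T'
  proof -
    obtain S' \<epsilon> where S': "S' \<subseteq> ntuples T' n" "rapid S'" "S' \<approx> (UNIV :: 'a set)" and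
      sep: "\<forall>S\<subseteq>S'. S \<approx> (UNIV :: 'a set) \<longrightarrow> (\<forall>\<zeta>. \<exists>\<sigma>\<in>S. (\<forall>x\<in>set \<sigma>. \<zeta> < fst x) \<and>
       (\<forall>\<delta>. \<epsilon> < \<delta> \<longrightarrow> \<delta> < \<zeta> \<longrightarrow> inj_on (\<lambda>k. length (snd (\<sigma> ! k) \<delta>)) {..<n}))"
      using separated_family[OF T' n_pos] by blast
    have "\<exists>xs\<in>S. \<exists>ys\<in>S. good_pair ?c n 1 \<tau> xs ys" if S: "S \<subseteq> S'" "S \<approx> (UNIV :: 'a set)" for S \<tau>
    proof -
      let ?cs = "map \<tau> [0..<n]"
      have "\<exists>xs\<in>S. \<exists>ys\<in>S. good_pair ?c n 1 ((!) ?cs) xs ys"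
      proof (rule realise)
        show "S \<subseteq> ntuples (rho0_tree C) n" using S(1) S'(1) T'(1) unfolding ntuples_def by blast
        show "rapid S" using S(1) S'(2) unfolding rapid_def by blast
        \<comment> \<open>Pairwise different lengths leave no two coordinates to compare, so
          arbitrary colours are admissible.\<close>
        have adm: "admissible ?cs \<delta> \<sigma>" if "inj_on (\<lambda>k. length (snd (\<sigma> ! k) \<delta>)) {..<n}"
          for \<delta> :: 'a and \<sigma>
          using that by (auto simp: admissible_def inj_on_def)
        show "\<exists>\<sigma>\<in>S. (\<forall>x\<in>set \<sigma>. \<zeta> < fst x) \<and> (\<forall>\<delta>\<in>A_set C. \<epsilon> < \<delta> \<longrightarrow> \<delta> < \<zeta> \<longrightarrow> admissible ?cs \<delta> \<sigma>)" for \<zeta>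
        proof -
          obtain \<sigma> where "\<sigma> \<in> S" "\<forall>x\<in>set \<sigma>. \<zeta> < fst x"
            "\<forall>\<delta>. \<epsilon> < \<delta> \<longrightarrow> \<delta> < \<zeta> \<longrightarrow> inj_on (\<lambda>k. length (snd (\<sigma> ! k) \<delta>)) {..<n}"
            using sep[rule_format, OF S, of \<zeta>] by (elim bexE conjE)
          then show ?thesis using adm by (intro bexI[of _ \<sigma>]) auto
        qed
      qed simp
      then obtain xs ys where "xs \<in> S" "ys \<in> S" "good_pair ?c n 1 ((!) ?cs) xs ys" by blast
      then show ?thesis using cong[of ?cs xs ys \<tau>] by auto
    qed
    then show ?thesis using S' by (intro exI[of _ S']) auto
  qed
  show ?thesis unfolding tree_negpart_def
  proof (intro exI[of _ ?c] conjI allI impI ballI UNIV_I)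
    fix S :: "'a node list set" and \<tau> :: 'm
    assume "S \<subseteq> ntuples (rho0_tree C) n \<and> rapid S \<and> S \<approx> (UNIV::'a set)"
    then show "\<exists>xs\<in>S. \<exists>ys\<in>S. good_pair ?c n 1 (\<lambda>_. \<tau>) xs ys" using 1 by blast
  next
    fix T' :: "'a node set" assume T': "T' \<subseteq> rho0_tree C \<and> T' \<approx> (UNIV::'a set)"
    show "\<exists>S'. S' \<subseteq> ntuples T' n \<and> rapid S' \<and> S' \<approx> (UNIV::'a set) \<and>
      (\<forall>S. S \<subseteq> S' \<and> S \<approx> (UNIV::'a set) \<longrightarrow> (\<forall>\<tau>. (\<forall>k<n. \<tau> k \<in> UNIV) \<longrightarrow>
        (\<exists>xs\<in>S. \<exists>ys\<in>S. good_pair ?c n 1 \<tau> xs ys)))"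
      using 2[OF conjunct1[OF T'] conjunct2[OF T']] by simp
  qed
qed

end
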